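(* Let $\overline\mu=(\overline\mu_a)_{a\in\mathcal A}$ be the vector of Rauzy measures corresponding to a compatible, irreducible Pisot random substitution $\vartheta_{\mathbf P}=(\vartheta,\mathbf P)$ on $\mathcal A=\{1,\dots,d\}$. Then $$\sum_{j\in\mathcal J}\sum_{a\in\mathcal A}\overline\mu_a\circ t_j^{-1}=D\,\mathrm{Leb},$$ where $\mathrm{Leb}$ is Lebesgue measure on $\mathbb H$ and $D$ is the density of points in $\mathcal J$.
   Context: Let $\mathcal A^+$ be the set of non-empty finite words over $\mathcal A$, $|u|$ the length of $u$, $|u|_i$ the number of occurrences of $i$ in $u$, $\psi(u)=(|u|_1,\dots,|u|_d)^T$, and $u_{[1,m]}=u_1\cdots u_m$ (empty if $m=0$). A random substitution $\vartheta_{\mathbf P}=(\vartheta,\mathbf P)$ is a map $\vartheta$ assigning to each letter $i$ a non-empty finite set $\vartheta(i)\subset\mathcal A^+$ together with probability vectors $p_i\colon\vartheta(i)\to(0,1]$, $\sum_{v\in\vartheta(i)}p_i(v)=1$. For a word $u=u_1\cdots u_n$, $\vartheta_{\mathbf P}(u)$ is the random word obtained by independently replacing each letter $u_k$ by $v\in\vartheta(u_k)$ with probability $p_{u_k}(v)$ and concatenating in order; $(\vartheta_{\mathbf P}^n(u))_{n\ge0}$ is the Markov chain on $\mathcal A^+$ started at $u$ with these transition probabilities, and $\mathbb E$ is the corresponding expectation. It is compatible if $\psi(u)=\psi(v)$ for all $a\in\mathcal A$, $u,v\in\vartheta(a)$; then all realisations of $\vartheta_{\mathbf P}^n(v)$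 have a common length $|\vartheta^n(v)|$, and the substitution matrix is $M_{i,j}=|v|_i$ for any $v\in\vartheta(j)$. It is primitive if $M$ is primitive with Perron–Frobenius eigenvalue $\lambda>1$. A compatible primitive random substitution is irreducible Pisot if $\lambda$ is a Pisot number and the characteristic polynomial of $M$ is irreducible over $\mathbb Z$. $\mathbf L,\mathbf R$ are left and right Perron–Frobenius eigenvectors of $M$ with $\|\mathbf R\|_1=1=\mathbf L^T\mathbf R$; $\mathbb H\subset\mathbb R^d$ is the hyperplane orthogonal to $\mathbf L$; $\pi$ is the linear projection along $\mathbf R$ onto $\mathbb H$. For a finite word $w$ and $a\in\mathcal A$, $\mu_a(w)=\sum_{0\le m\le|w|-1,\ w_{m+1}=a}\delta_{\pi(\psi(w_{[1,m]}))}$. The Rauzy measure $\overline\mu_a$ is the weak limit $\overline\mu_a=\lim_{n\to\infty}|\vartheta^n(v)|^{-1}\,\mathbb E[\mu_a(\vartheta_{\mathbf P}^n(v))]$, which exists and is the same for every $v\in\mathcal A^+$ (these are, up to normalisation by total mass, the self-similar measures of a graph-directed iterated function system). $\mathcal J\subset\mathbb H$ is the lattice given by the integer span of $\pi(\mathbf e_i-\mathbf e_1)$, $2\le i\le d$, with $(\mathbf e_i)$ the standard basis of $\mathbb R^d$; its density $D$ is the reciprocal of the Lebesgue measure of a fundamental domain. $t_j\colon\mathbb H\to\mathbb H$, $t_j(x)=x+j$. *)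

theory Defs
  imports "HOL-Probability.Probability" "HOL-Computational_Algebra.Computational_Algebra"
begin

fun matrix_power :: "'b::semiring_1 ^ 'n ^ 'n \<Rightarrow> nat \<Rightarrow> 'b ^ 'n ^ 'n" where
  "matrix_power A 0 = mat 1"
| "matrix_power A (Suc k) = A ** matrix_power A k"

definition primitive_matrix :: "real ^ 'n ^ 'n \<Rightarrow> bool" where
  "primitive_matrix A \<longleftrightarrow>
     (\<forall>i j. 0 \<le> A $ i $ j) \<and> (\<exists>k>0. \<forall>i j. 0 < matrix_power A k $ i $ j)"

definition charpoly :: "'b::comm_ring_1 ^ 'n ^ 'n \<Rightarrow> 'b poly" where
  "charpoly A = det (\<chi> i j. (if i = j then [:0, 1:] else 0) - [:A $ i $ j:])"

definition is_eigenvalue :: "'b::field ^ 'n ^ 'n \<Rightarrow> 'b \<Rightarrow> bool" where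
  "is_eigenvalue A c \<longleftrightarrow> (\<exists>x. x \<noteq> 0 \<and> A *v x = c *s x)"

text \<open>The Perron--Frobenius eigenvalue is the positive eigenvalue that is strictly larger in modulus
  than every other complex eigenvalue; there is at most one such number.\<close>

definition pf_eigenvalue :: "real ^ 'n ^ 'n \<Rightarrow> real \<Rightarrow> bool" where
  "pf_eigenvalue A l \<longleftrightarrow> 0 < l \<and> is_eigenvalue A l \<and>
     (\<forall>z. is_eigenvalue (\<chi> i j. complex_of_real (A $ i $ j)) z \<and> z \<noteq> complex_of_real l
        \<longrightarrow> cmod z < l)"

text \<open>Left (\<open>L\<close>) and right (\<open>R\<close>) Perron--Frobenius eigenvectors, taken positive and normalised
  by \<open>\<parallel>R\<parallel>\<^sub>1 = 1 = L\<^sup>T R\<close>.\<close>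

definition pf_eigenvectors :: "real ^ 'n ^ 'n \<Rightarrow> real ^ 'n \<Rightarrow> real ^ 'n \<Rightarrow> bool" where
  "pf_eigenvectors A L R \<longleftrightarrow>
     (\<exists>l. pf_eigenvalue A l \<and> L v* A = l *s L \<and> A *v R = l *s R) \<and>
     (\<forall>i. 0 < L $ i) \<and> (\<forall>i. 0 < R $ i) \<and>
     (\<Sum>i\<in>UNIV. \<bar>R $ i\<bar>) = 1 \<and> L \<bullet> R = 1"

text \<open>A monic irreducible integer polynomial with root \<open>x\<close> is the minimal polynomial of \<open>x\<close>, so its
  other complex roots are the Galois conjugates of \<open>x\<close>.\<close>

definition pisot_number :: "real \<Rightarrow> bool" where
  "pisot_number x \<longleftrightarrow> 1 < x \<and>
     (\<exists>p :: int poly. lead_coeff p = 1 \<and> irreducible p \<and> poly (map_poly of_int p) x = 0 \<and>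
        (\<forall>z :: complex. poly (map_poly of_int p) z = 0 \<and> z \<noteq> complex_of_real x \<longrightarrow> cmod z < 1))"

text \<open>A random substitution on the finite alphabet \<open>'a\<close> is encoded by the distributions \<open>P a\<close> of the
  image of each letter: \<open>\<vartheta>(a) = set_pmf (P a)\<close> and \<open>p\<^sub>a(v) = pmf (P a) v\<close>.\<close>

definition random_substitution :: "('a::finite \<Rightarrow> 'a list pmf) \<Rightarrow> bool" where
  "random_substitution P \<longleftrightarrow> (\<forall>a. finite (set_pmf (P a)) \<and> [] \<notin> set_pmf (P a))"

primrec subst_word :: "('a \<Rightarrow> 'a list pmf) \<Rightarrow> 'a list \<Rightarrow> 'a list pmf" where
  "subst_word P [] = return_pmf []"
| "subst_word P (a # u) =
     bind_pmf (P a) (\<lambda>v. bind_pmf (subst_word P u) (\<lambda>w. return_pmf (v @ w)))"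

text \<open>Distribution at time \<open>n\<close> of the Markov chain with transition kernel \<^term>\<open>subst_word P\<close>
  started at \<open>u\<close>.\<close>

primrec subst_chain :: "('a \<Rightarrow> 'a list pmf) \<Rightarrow> nat \<Rightarrow> 'a list \<Rightarrow> 'a list pmf" where
  "subst_chain P 0 u = return_pmf u"
| "subst_chain P (Suc n) u = bind_pmf (subst_chain P n u) (subst_word P)"

definition abelianisation :: "'a list \<Rightarrow> real ^ 'a" where
  "abelianisation u = (\<chi> i. real (count_list u i))"

definition compatible :: "('a::finite \<Rightarrow> 'a list pmf) \<Rightarrow> bool" where
  "compatible P \<longleftrightarrow>
     (\<forall>a. \<forall>u\<in>set_pmf (P a). \<forall>v\<in>set_pmf (P a). abelianisation u = abelianisation v)"

text \<open>For compatible \<open>P\<close>, the choices in the next two definitions do not matter.\<close>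

definition subst_matrix :: "('a::finite \<Rightarrow> 'a list pmf) \<Rightarrow> 'b::semiring_1 ^ 'a ^ 'a" where
  "subst_matrix P = (\<chi> i j. of_nat (count_list (SOME v. v \<in> set_pmf (P j)) i))"

definition subst_length :: "('a \<Rightarrow> 'a list pmf) \<Rightarrow> nat \<Rightarrow> 'a list \<Rightarrow> nat" where
  "subst_length P n v = length (SOME w. w \<in> set_pmf (subst_chain P n v))"

definition primitive_substitution :: "('a::finite \<Rightarrow> 'a list pmf) \<Rightarrow> bool" where
  "primitive_substitution P \<longleftrightarrow>
     primitive_matrix (subst_matrix P) \<and> (\<exists>l>1. pf_eigenvalue (subst_matrix P) l)"

definition irreducible_pisot :: "('a::finite \<Rightarrow> 'a list pmf) \<Rightarrow> bool" where
  "irreducible_pisot P \<longleftrightarrow>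
     compatible P \<and> primitive_substitution P \<and>
     (\<exists>l. pf_eigenvalue (subst_matrix P) l \<and> pisot_number l) \<and>
     irreducible (charpoly (subst_matrix P :: int ^ 'a ^ 'a))"

definition hyperplane :: "real ^ 'a \<Rightarrow> (real ^ 'a) set" where
  "hyperplane L = {x. L \<bullet> x = 0}"

text \<open>When \<open>L \<bullet> R = 1\<close>, this is the linear projection onto \<^term>\<open>hyperplane L\<close> with kernel spanned
  by \<open>R\<close>.\<close>

definition proj_along :: "real ^ 'a \<Rightarrow> real ^ 'a \<Rightarrow> real ^ 'a \<Rightarrow> real ^ 'a" where
  "proj_along L R x = x - (L \<bullet> x) *\<^sub>R R"

definition borel_on :: "'b::topological_space set \<Rightarrow> 'b measure" where
  "borel_on H = restrict_space borel H"

text \<open>Lebesgue measure on a linear subspace, constructed like \<^const>\<open>lborel\<close> but with an orthonormal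
  basis of the subspace in place of \<^const>\<open>Basis\<close>; it does not depend on the choice. On the zero
  subspace it is the unit point mass.\<close>

definition subspace_lborel :: "'b::euclidean_space set \<Rightarrow> 'b measure" where
  "subspace_lborel H =
     (let B = (SOME B. pairwise orthogonal B \<and> (\<forall>b\<in>B. norm b = 1) \<and> span B = H)
      in distr (\<Pi>\<^sub>M b\<in>B. lborel) (borel_on H) (\<lambda>f. \<Sum>b\<in>B. f b *\<^sub>R b))"

text \<open>The sum of the Dirac measures at \<open>\<pi>(\<psi>(w\<^bsub>[1,m]\<^esub>))\<close> over the positions \<open>m\<close> with \<open>w\<^bsub>m+1\<^esub> = a\<close>
  (which is \<open>w ! m\<close>, as list indices start at 0), as a pushforward of counting measure.\<close>

definition word_measure ::
    "real ^ 'a \<Rightarrow> real ^ 'a \<Rightarrow> 'a \<Rightarrow> 'a list \<Rightarrow> (real ^ 'a) measure" where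
  "word_measure L R a w =
     distr (count_space {m. m < length w \<and> w ! m = a}) (borel_on (hyperplane L))
       (\<lambda>m. proj_along L R (abelianisation (take m w)))"

definition expected_measure :: "'c pmf \<Rightarrow> 'b measure \<Rightarrow> ('c \<Rightarrow> 'b measure) \<Rightarrow> 'b measure" where
  "expected_measure p M K =
     measure_of (space M) (sets M) (\<lambda>B. \<integral>\<^sup>+ w. emeasure (K w) B \<partial>measure_pmf p)"

definition weak_limit_on ::
    "'b::topological_space set \<Rightarrow> (nat \<Rightarrow> 'b measure) \<Rightarrow> 'b measure \<Rightarrow> bool" where
  "weak_limit_on H N M \<longleftrightarrow>
     sets M = sets (borel_on H) \<and> finite_measure M \<and>
     (\<forall>f :: 'b \<Rightarrow> real. continuous_on H f \<and> bounded (f ` H)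
        \<longrightarrow> (\<lambda>n. integral\<^sup>L (N n) f) \<longlonglongrightarrow> integral\<^sup>L M f)"

text \<open>\<open>m\<close> is the weak limit of \<open>|\<vartheta>\<^sup>n(v)|\<^sup>-\<^sup>1 \<bbbE>[\<mu>\<^sub>a(\<vartheta>\<^sub>P\<^sup>n(v))]\<close> for the initial word \<open>v\<close>.\<close>

definition is_rauzy_measure ::
    "('a::finite \<Rightarrow> 'a list pmf) \<Rightarrow> real ^ 'a \<Rightarrow> real ^ 'a \<Rightarrow> 'a list \<Rightarrow> 'a
      \<Rightarrow> (real ^ 'a) measure \<Rightarrow> bool" where
  "is_rauzy_measure P L R v a m \<longleftrightarrow>
     weak_limit_on (hyperplane L)
       (\<lambda>n. scale_measure (1 / of_nat (subst_length P n v))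
          (expected_measure (subst_chain P n v) (borel_on (hyperplane L)) (word_measure L R a)))
       m"

text \<open>\<open>a\<^sub>1\<close> is the letter called 1; any letter of the alphabet may play this role.\<close>

definition rauzy_lattice :: "real ^ 'a \<Rightarrow> real ^ 'a \<Rightarrow> 'a \<Rightarrow> (real ^ 'a) set" where
  "rauzy_lattice L R a\<^sub>1 =
     range (\<lambda>c :: 'a \<Rightarrow> int.
       \<Sum>i\<in>UNIV - {a\<^sub>1}. of_int (c i) *\<^sub>R proj_along L R (axis i 1 - axis a\<^sub>1 1))"

definition fundamental_domain ::
    "'b::real_normed_vector set \<Rightarrow> 'b set \<Rightarrow> 'b set \<Rightarrow> bool" where
  "fundamental_domain H J F \<longleftrightarrow>
     F \<in> sets (borel_on H) \<and> (\<forall>x\<in>H. \<exists>!j. j \<in> J \<and> x - j \<in> F)"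

end

theory Submission
  imports Defs
begin

text \<open>
  The proper prefixes of a word of length \<open>N\<close> have as abelianisations one integer point for each
  coordinate sum \<open>0, \<dots>, N - 1\<close>. Two integer points with the same coordinate sum have projections that differ by an
  element of the lattice \<open>J\<close>. Hence, modulo \<open>J\<close>, the point masses that make up
  \<open>\<Sum>\<^sub>a \<mu>\<^sub>a(w)\<close> sit at \<open>0, \<alpha>, 2\<alpha>, \<dots>, (N - 1)\<alpha>\<close> with \<open>\<alpha> = \<pi>(e\<^sub>1)\<close>, whatever the word \<open>w\<close> is: neither
  the substitution nor the randomness is visible any more. Consequently the sum \<open>m\<close> of the Rauzy measures
  integrates a \<open>J\<close>-periodic continuous function to the limit of its averages along the orbit of \<open>0\<close>
  under the rotation by \<open>\<alpha>\<close> (\<open>rauzy_measure_orbit_average\<close>).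

  Such a limit is unchanged when the function is translated by \<open>\<alpha>\<close> (\<open>orbit_average_shift\<close>), and so it
  is unchanged under the group \<open>\<int>\<alpha> + J = \<pi>(\<int>\<^sup>d)\<close>. This group is dense in the hyperplane by Kronecker's
  theorem (\<open>integer_projections_dense\<close>), because the entries of the right eigenvector \<open>R\<close> are
  rationally independent: an integral relation between them would give a nonzero integer
  polynomial that vanishes at the Perron--Frobenius eigenvalue and has smaller degree than the irreducible
  characteristic polynomial (\<open>eigenvector_rationally_independent\<close>). By continuity, \<open>m\<close> is
  therefore invariant under all translations as far as \<open>J\<close>-periodic sets are concerned.

  A Fubini argument, the one that proves uniqueness of Haar measure, then compares \<open>m\<close> with
  Lebesgue measure on \<open>J\<close>-periodic sets (\<open>emeasure_periodic_eq\<close>). An open set that is too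
  small to meet any of its own \<open>J\<close>-translates is a fundamental domain of its \<open>J\<close>-saturation, so for it the
  comparison becomes the proportionality of \<open>\<Sum>\<^sub>j m \<circ> t\<^sub>j\<^sup>-\<^sup>1\<close> and Lebesgue measure. These small
  sets generate the Borel sets (\<open>periodisation_eq_lebesgue\<close>). The constant is the density of \<open>J\<close>
  because \<open>m\<close> has total mass \<open>1\<close>.
\<close>

section \<open>Rational independence of eigenvector entries\<close>

definition int_poly_eval :: "int poly \<Rightarrow> real \<Rightarrow> real" where
  "int_poly_eval p x = poly (map_poly of_int p) x"

lemma int_poly_eval_add: "int_poly_eval (p + q) x = int_poly_eval p x + int_poly_eval q x"
proof -
  have "(map_poly of_int (p + q) :: real poly) = map_poly of_int p + map_poly of_int q"
    by (intro poly_eqI) (simp add: coeff_map_poly)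
  then show ?thesis
    by (simp add: int_poly_eval_def)
qed

lemma int_poly_eval_mult: "int_poly_eval (p * q) x = int_poly_eval p x * int_poly_eval q x"
proof -
  have "(map_poly of_int (p * q) :: real poly) = map_poly of_int p * map_poly of_int q"
    by (intro poly_eqI) (simp add: coeff_map_poly coeff_mult)
  then show ?thesis
    by (simp add: int_poly_eval_def)
qed

lemma int_poly_eval_pCons: "int_poly_eval (pCons a p) x = of_int a + x * int_poly_eval p x"
  by (simp add: int_poly_eval_def map_poly_pCons)

lemma int_poly_eval_0 [simp]: "int_poly_eval 0 x = 0"
  by (simp add: int_poly_eval_def)

lemma int_poly_eval_1 [simp]: "int_poly_eval 1 x = 1"
  by (simp add: int_poly_eval_def)

lemma int_poly_eval_minus: "int_poly_eval (- p) x = - int_poly_eval p x"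
  using int_poly_eval_add[of p "- p" x] by (simp add: eq_neg_iff_add_eq_0 add.commute)

lemma int_poly_eval_diff: "int_poly_eval (p - q) x = int_poly_eval p x - int_poly_eval q x"
  using int_poly_eval_add[of p "- q" x] by (simp add: int_poly_eval_minus)

lemma int_poly_eval_smult: "int_poly_eval (smult a p) x = of_int a * int_poly_eval p x"
  using int_poly_eval_mult[of "[:a:]" p x] by (simp add: int_poly_eval_pCons)

lemma int_poly_eval_of_int: "int_poly_eval (of_int k) x = of_int k"
  using int_poly_eval_pCons[of k 0 x] by (simp add: of_int_poly)

lemma int_poly_eval_sum: "int_poly_eval (\<Sum>i\<in>S. f i) x = (\<Sum>i\<in>S. int_poly_eval (f i) x)"
  by (induction S rule: infinite_finite_induct) (auto simp: int_poly_eval_add)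

lemma int_poly_eval_prod: "int_poly_eval (\<Prod>i\<in>S. f i) x = (\<Prod>i\<in>S. int_poly_eval (f i) x)"
  by (induction S rule: infinite_finite_induct) (auto simp: int_poly_eval_mult)

lemma int_poly_eval_det:
  fixes A :: "int poly ^ 'n ^ 'n"
  shows "int_poly_eval (det A) x = det (\<chi> i j. int_poly_eval (A $ i $ j) x)"
  by (simp add: det_def int_poly_eval_sum int_poly_eval_mult int_poly_eval_prod
      int_poly_eval_of_int)

text \<open>An irreducible integer polynomial has minimal degree among the nonzero integer polynomials
  that share a given root with it. Pseudo-division replaces the division that \<open>\<int>[x]\<close> lacks: a polynomial
  \<open>g\<close> of minimal degree divides a constant multiple of \<open>p\<close>, and since irreducible elements of
  \<open>\<int>[x]\<close> are prime, \<open>p\<close> has to divide \<open>g\<close>.\<close>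

lemma irreducible_degree_le:
  fixes p q :: "int poly" and x :: real
  assumes irr: "irreducible p" and px: "int_poly_eval p x = 0"
    and q: "q \<noteq> 0" and qx: "int_poly_eval q x = 0"
  shows "degree p \<le> degree q"
proof -
  define Q where "Q = (\<lambda>g::int poly. g \<noteq> 0 \<and> int_poly_eval g x = 0)"
  (* Q g: g is a candidate for the minimal polynomial of x, up to a constant factor *)
  have "Q q"
    using q qx by (simp add: Q_def)
  then obtain g where g: "Q g" and least: "\<And>h. Q h \<Longrightarrow> degree g \<le> degree h"
    using ex_has_least_nat[of Q q degree] by blast
  have g0: "g \<noteq> 0" and gx: "int_poly_eval g x = 0"
    using g by (auto simp: Q_def)
  obtain a s where a: "a \<noteq> 0" and as: "smult a p = g * s + pseudo_mod p g"
    using pseudo_mod(1)[OF g0, of p] by blast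
  have "int_poly_eval (smult a p) x = int_poly_eval (g * s) x + int_poly_eval (pseudo_mod p g) x"
    by (simp add: as int_poly_eval_add)
  then have "int_poly_eval (pseudo_mod p g) x = 0"
    by (simp add: int_poly_eval_smult int_poly_eval_mult px gx)
  then have "pseudo_mod p g = 0"
    using pseudo_mod(2)[OF g0, of p] least[of "pseudo_mod p g"] unfolding Q_def by force
  then have eq: "smult a p = g * s"
    using as by simp
  have "prime_elem p"
    using irr irreducible_imp_prime_elem_gcd by blast
  moreover have "p dvd g * s"
    unfolding eq[symmetric] by (simp add: dvd_smult)
  ultimately consider "p dvd g" | "p dvd s"
    by (auto simp: prime_elem_dvd_mult_iff)
  then show ?thesis
  proof cases
    case 1
    then have "degree p \<le> degree g"
      using g0 by (rule dvd_imp_degree_le)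
    also have "\<dots> \<le> degree q"
      using least \<open>Q q\<close> by blast
    finally show ?thesis .
  next
    case 2
    have p0: "p \<noteq> 0"
      using irr by auto
    have s0: "s \<noteq> 0"
      using eq a p0 by auto
    have "degree p = degree g + degree s"
      using arg_cong[OF eq, of degree] a g0 s0 by (simp add: degree_mult_eq)
    moreover have "degree p \<le> degree s"
      using 2 s0 by (rule dvd_imp_degree_le)
    ultimately have "degree g = 0"
      by simp
    then obtain c where "g = [:c:]"
      using degree_eq_zeroE by blast
    then show ?thesis
      using g0 gx by (simp add: int_poly_eval_pCons)
  qed
qed

lemma degree_coeff_prod_linear:
  fixes b c :: "'i \<Rightarrow> 'b::comm_ring_1"
  assumes "finite S"
  shows "degree (\<Prod>i\<in>S. [:b i, c i:]) \<le> card S"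
    and "coeff (\<Prod>i\<in>S. [:b i, c i:]) (card S) = (\<Prod>i\<in>S. c i)"
  using assms
proof (induction S rule: finite_induct)
  case (insert i S)
  have "degree (\<Prod>i\<in>insert i S. [:b i, c i:]) \<le> degree [:b i, c i:] + card S"
    using insert.IH(1) insert.hyps degree_mult_le[of "[:b i, c i:]" "\<Prod>i\<in>S. [:b i, c i:]"]
    by simp
  then show "degree (\<Prod>i\<in>insert i S. [:b i, c i:]) \<le> card (insert i S)"
    using insert.hyps by (simp split: if_splits)
  have z: "coeff (\<Prod>i\<in>S. [:b i, c i:]) (Suc (card S)) = 0"
    using insert.IH(1) by (simp add: coeff_eq_0)
  show "coeff (\<Prod>i\<in>insert i S. [:b i, c i:]) (card (insert i S)) = (\<Prod>i\<in>insert i S. c i)"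
    using insert.hyps insert.IH(2) z by (simp add: mult.commute)
qed auto

text \<open>The top coefficient is the determinant of the matrix of linear coefficients, the identity.\<close>

lemma coeff_charpoly_card:
  fixes A :: "int ^ 'n ^ 'n"
  shows "coeff (charpoly A) CARD('n) = 1"
proof -
  have entry: "((if i = j then [:0, 1:] else 0) - [:A $ i $ j:]) = [:- (A $ i $ j), mat 1 $ i $ j:]"
    for i j
    by (auto simp: mat_def)
  have "coeff (charpoly A) CARD('n) = det (mat 1 :: int ^ 'n ^ 'n)"
    unfolding charpoly_def det_def entry
    by (simp add: coeff_sum of_int_poly degree_coeff_prod_linear(2))
  then show ?thesis
    by simp
qed

text \<open>Let \<open>n\<close> be an integral relation between the entries of \<open>R\<close> with \<open>n j \<noteq> 0\<close>. Replacing row \<open>j\<close> of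
  \<open>x I - A\<close> by \<open>n\<close> gives a matrix that at \<open>x = l\<close> still annihilates \<open>R\<close>, so its determinant is a
  polynomial with root \<open>l\<close>. Its degree is at most \<open>CARD('n) - 1\<close>, and to the
  coefficient of that degree, which is \<open>n j\<close>, only the identity permutation contributes. So it is a
  nonzero polynomial of smaller degree than the irreducible characteristic polynomial, with the same
  root.\<close>

lemma eigenvector_rationally_independent:
  fixes A :: "int ^ 'n ^ 'n" and R :: "real ^ 'n" and n :: "'n \<Rightarrow> int"
  assumes irr: "irreducible (charpoly A)"
    and ev: "(\<chi> i j. of_int (A $ i $ j)) *v R = l *s R" and R: "R \<noteq> 0"
    and rel: "(\<Sum>i\<in>UNIV. of_int (n i) * R $ i) = 0"
  shows "n j = 0"
proof (rule ccontr)
  assume nj: "n j \<noteq> 0"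
  define Q where "Q = (\<chi> i k. if i = j then [:n k:]
      else (if i = k then [:0, 1:] else 0) - [:A $ i $ k:])"
  have kernel: "(\<Sum>k\<in>UNIV. (if i = k then l else 0) * R $ k - of_int (A $ i $ k) * R $ k) = 0" for i
  proof -
    have "(\<Sum>k\<in>UNIV. of_int (A $ i $ k) * R $ k) = l * R $ i"
      using arg_cong[OF ev, of "\<lambda>x. x $ i"] by (simp add: matrix_vector_mult_def)
    moreover have "(\<Sum>k\<in>UNIV. (if i = k then l else 0) * R $ k) = l * R $ i"
      by (simp add: if_distrib[of "\<lambda>x. x * _"] cong: if_cong)
    ultimately show ?thesis
      by (simp add: sum_subtractf)
  qed
  have entry_eval: "int_poly_eval ((if i = k then [:0, 1:] else 0) - [:A $ i $ k:]) l =
      (if i = k then l else 0) - of_int (A $ i $ k)" for i k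
    by (simp add: int_poly_eval_diff int_poly_eval_pCons)
  have sing: "det B = 0" if "B *v R = 0" for B :: "real ^ 'n ^ 'n"
  proof (rule ccontr)
    assume "det B \<noteq> 0"
    then have "invertible B"
      by (simp add: invertible_det_nz)
    then obtain C where "C ** B = mat 1"
      by (auto simp: invertible_def)
    then have "R = C *v (B *v R)"
      by (simp add: matrix_vector_mul_assoc)
    then show False
      using that R by simp
  qed
  have root: "int_poly_eval (charpoly A) l = 0"
    unfolding charpoly_def int_poly_eval_det
    by (rule sing) (use kernel in \<open>simp add: vec_eq_iff matrix_vector_mult_def entry_eval algebra_simps\<close>)
  have rootQ: "int_poly_eval (det Q) l = 0"
    unfolding Q_def int_poly_eval_det
  proof (rule sing, rule vec_eq_iff[THEN iffD2], rule allI)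
    fix i
    show "((\<chi> i k. int_poly_eval ((\<chi> i k. if i = j then [:n k:]
        else (if i = k then [:0, 1:] else 0) - [:A $ i $ k:]) $ i $ k) l) *v R) $ i = 0 $ i"
      using kernel[of i] rel
      by (cases "i = j") (simp_all add: matrix_vector_mult_def int_poly_eval_pCons entry_eval algebra_simps)
  qed
  have row_product: "degree (\<Prod>i\<in>UNIV. Q $ i $ p i) \<le> CARD('n) - 1 \<and>
      coeff (\<Prod>i\<in>UNIV. Q $ i $ p i) (CARD('n) - 1) = n (p j) * (\<Prod>i\<in>UNIV - {j}. if i = p i then 1 else 0)" for p
  proof -
    let ?P = "\<Prod>i\<in>UNIV - {j}. [:- (A $ i $ p i), if i = p i then 1 else 0:]"
    have "(\<Prod>i\<in>UNIV. Q $ i $ p i) = Q $ j $ p j * (\<Prod>i\<in>UNIV - {j}. Q $ i $ p i)"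
      by (simp add: prod.remove)
    also have "(\<Prod>i\<in>UNIV - {j}. Q $ i $ p i) = ?P"
      by (intro prod.cong) (auto simp: Q_def)
    finally have "(\<Prod>i\<in>UNIV. Q $ i $ p i) = smult (n (p j)) ?P"
      by (simp add: Q_def)
    then show ?thesis
      using degree_coeff_prod_linear[of "UNIV - {j}" "\<lambda>i. - (A $ i $ p i)" "\<lambda>i. if i = p i then 1 else 0"]
      by (simp add: card_Diff_singleton)
  qed
  have deg: "degree (det Q) \<le> CARD('n) - 1"
    unfolding det_def
    by (intro degree_sum_le) (auto simp: of_int_poly intro!: order_trans[OF degree_smult_le] row_product[THEN conjunct1, unfolded One_nat_def])
  have "coeff (det Q) (CARD('n) - 1) = n j"
  proof -
    have "coeff (det Q) (CARD('n) - 1) = (\<Sum>p | p permutes UNIV. sign p *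
        (n (p j) * (\<Prod>i\<in>UNIV - {j}. if i = p i then 1 else 0)))"
      by (simp add: det_def coeff_sum of_int_poly row_product[THEN conjunct2, unfolded One_nat_def] del: prod_zero_iff)
    also have "\<dots> = (\<Sum>p\<in>{id}. sign p * (n (p j) * (\<Prod>i\<in>UNIV - {j}. if i = p i then 1 else 0)))"
    proof (intro sum.mono_neutral_right ballI)
      fix p assume "p \<in> {p. p permutes (UNIV :: 'n set)} - {id}"
      then have p: "p permutes (UNIV :: 'n set)" "p \<noteq> id"
        by auto
      have "\<exists>i. i \<noteq> j \<and> p i \<noteq> i"
      proof (rule ccontr)
        assume "\<not> ?thesis"
        then have "p permutes {j}"
          using p(1) by (auto simp: permutes_def)
        then show False
          using p(2) by (simp add: permutes_sing)
      qed
      then obtain i where "i \<noteq> j" "p i \<noteq> i"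
        by blast
      then have "(\<Prod>i\<in>UNIV - {j}. if i = p i then 1 else 0 :: int) = 0"
        by (intro prod_zero) (auto intro!: bexI[of _ i])
      then show "sign p * (n (p j) * (\<Prod>i\<in>UNIV - {j}. if i = p i then 1 else 0)) = 0"
        by simp
    qed (auto simp: permutes_id)
    finally show ?thesis
      by simp
  qed
  then have "det Q \<noteq> 0"
    using nj by auto
  then have "degree (charpoly A) \<le> CARD('n) - 1"
    using irreducible_degree_le[OF irr root _ rootQ] deg by simp
  then have "coeff (charpoly A) CARD('n) = 0"
    by (intro coeff_eq_0) (use zero_less_card_finite[where 'a='n] in linarith)
  then show False
    by (simp add: coeff_charpoly_card)
qed

section \<open>Projections of integer points\<close>

lemma linear_proj_along: "linear (proj_along L R)"
  by (rule linearI) (simp_all add: proj_along_def inner_add_right algebra_simps)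

lemma proj_along_in_hyperplane: "L \<bullet> R = 1 \<Longrightarrow> proj_along L R x \<in> hyperplane L"
  by (simp add: proj_along_def hyperplane_def inner_diff_right)

lemma proj_along_hyperplane: "x \<in> hyperplane L \<Longrightarrow> proj_along L R x = x"
  by (simp add: proj_along_def hyperplane_def)

lemma proj_along_kernel: "L \<bullet> R = 1 \<Longrightarrow> proj_along L R (t *\<^sub>R R) = 0"
  by (simp add: proj_along_def)

text \<open>Kronecker's theorem provides a real \<open>t\<close> such that \<open>x + t R\<close> is close to an integer point.
  Projecting along \<open>R\<close> removes the term \<open>t R\<close>.\<close>

lemma integer_projections_dense:
  fixes L R :: "real ^ 'a"
  assumes LR: "L \<bullet> R = 1"
    and indep: "\<And>n :: 'a \<Rightarrow> int. (\<Sum>i\<in>UNIV. of_int (n i) * R $ i) = 0 \<Longrightarrow> \<forall>i. n i = 0"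
    and x: "x \<in> hyperplane L" and e: "e > 0"
  obtains n :: "'a \<Rightarrow> int" where "norm (proj_along L R (\<chi> i. of_int (n i)) - x) < e"
proof -
  interpret int_mod: Modules.module "\<lambda>r. (*) (real_of_int r)"
    by (simp add: Modules.module.intro distrib_left mult.commute)
  have inj: "inj (($) R)"
  proof (rule injI, rule ccontr)
    fix i j assume eq: "R $ i = R $ j" and ne: "i \<noteq> j"
    define n :: "'a \<Rightarrow> int" where "n = (\<lambda>k. (if k = i then 1 else 0) - (if k = j then 1 else 0))"
    have "(\<Sum>k\<in>UNIV. of_int (n k) * R $ k) =
        (\<Sum>k\<in>UNIV. (if k = i then R $ k else 0)) - (\<Sum>k\<in>UNIV. (if k = j then R $ k else 0))"
      unfolding sum_subtractf[symmetric] by (intro sum.cong) (auto simp: n_def)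
    then have "\<forall>k. n k = 0"
      using eq by (intro indep) simp
    then show False
      using ne by (auto simp: n_def dest: spec[of _ i])
  qed
  have independent: "int_mod.independent (range (($) R))"
    unfolding int_mod.dependent_finite[OF finite_imageI[OF finite]]
  proof (safe)
    fix u v i
    assume u: "(\<Sum>v\<in>range (($) R). real_of_int (u v) * v) = 0" and ui: "u (R $ i) \<noteq> 0"
    have "(\<Sum>i\<in>UNIV. real_of_int (u (R $ i)) * R $ i) = 0"
      using u by (simp add: sum.reindex[OF inj] o_def)
    then show False
      using indep[of "\<lambda>i. u (R $ i)"] ui by auto
  qed
  obtain b where b: "bij_betw b {..<CARD('a)} (UNIV :: 'a set)"
    using ex_bij_betw_nat_finite[of "UNIV :: 'a set"] by (auto simp: lessThan_atLeast0)
  define \<theta> where "\<theta> = (\<lambda>k. R $ b k)"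
  have range: "\<theta> ` {..<CARD('a)} = range (($) R)"
    using arg_cong[OF bij_betw_imp_surj_on[OF b], of "image (($) R)"]
    by (simp add: \<theta>_def image_image)
  have inj\<theta>: "inj_on \<theta> {..<CARD('a)}"
    using comp_inj_on[OF bij_betw_imp_inj_on[OF b] inj_on_subset[OF inj subset_UNIV]]
    by (simp add: \<theta>_def o_def)
  obtain K where K: "K > 0" "\<And>y. norm (proj_along L R y) \<le> K * norm y"
    using linear_bounded_pos[OF linear_proj_along, of L R] by (auto simp: mult.commute)
  (* Kronecker's theorem controls each coordinate; the factor CARD('a) passes to the norm
     and K to the projection. *)
  define \<epsilon> where "\<epsilon> = e / (K * CARD('a))"
  have \<epsilon>: "\<epsilon> > 0"
    using e K(1) by (simp add: \<epsilon>_def)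
  obtain t h where th: "\<And>k. k < CARD('a) \<Longrightarrow> \<bar>t * \<theta> k - of_int (h k) - (- x $ b k)\<bar> < \<epsilon>"
    using Kronecker_thm_1[OF independent[folded range] inj\<theta> \<epsilon>, of "\<lambda>k. - x $ b k"] by blast
  define n where "n = (\<lambda>i. h (inv_into {..<CARD('a)} b i))"
  define y where "y = (\<chi> i. real_of_int (n i)) - x - t *\<^sub>R R"
  have "\<bar>y $ i\<bar> < \<epsilon>" for i
  proof -
    define k where "k = inv_into {..<CARD('a)} b i"
    have "i \<in> b ` {..<CARD('a)}"
      using b by (simp add: bij_betw_def)
    then have "b k = i" "k \<in> {..<CARD('a)}"
      unfolding k_def by (rule f_inv_into_f, rule inv_into_into)
    then show ?thesis
      using th[of k] by (simp add: y_def n_def k_def \<theta>_def abs_minus_commute algebra_simps)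
  qed
  then have "norm y < (\<Sum>i\<in>(UNIV :: 'a set). \<epsilon>)"
    using norm_le_l1_cart[of y] by (intro le_less_trans[OF norm_le_l1_cart] sum_strict_mono) auto
  then have "K * norm y < e"
    using K(1) by (simp add: \<epsilon>_def field_simps)
  moreover have "proj_along L R y = proj_along L R (\<chi> i. of_int (n i)) - x"
    by (simp add: y_def linear_diff[OF linear_proj_along] proj_along_hyperplane[OF x]
        proj_along_kernel[OF LR])
  ultimately show ?thesis
    using K(2)[of y] by (intro that[of n]) simp
qed

text \<open>The generators \<open>\<pi>(e\<^sub>i - e\<^sub>a)\<close> are the projections of a basis of the integer points with coordinate
  sum zero. In this form the lattice visibly does not depend on the letter \<open>a\<close>.\<close>

lemma rauzy_lattice_iff:
  fixes L R :: "real ^ 'a"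
  shows "x \<in> rauzy_lattice L R a \<longleftrightarrow>
    (\<exists>n :: 'a \<Rightarrow> int. (\<Sum>i\<in>UNIV. n i) = 0 \<and> x = proj_along L R (\<chi> i. of_int (n i)))"
proof -
  have expand: "(\<Sum>i\<in>UNIV - {a}. of_int (c i) *\<^sub>R proj_along L R (axis i 1 - axis a 1)) =
      proj_along L R (\<chi> i. of_int (if i = a then - (\<Sum>i\<in>UNIV - {a}. c i) else c i))" for c :: "'a \<Rightarrow> int"
  proof -
    have "(\<Sum>i\<in>UNIV - {a}. of_int (c i) *\<^sub>R (axis i 1 - axis a 1)) =
       (\<chi> i. real_of_int (if i = a then - (\<Sum>i\<in>UNIV - {a}. c i) else c i))"
    proof (rule vec_eq_iff[THEN iffD2], rule allI)
      fix j
      have "(\<Sum>i\<in>UNIV - {a}. of_int (c i) *\<^sub>R (axis i 1 - axis a (1 :: real))) $ j =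
          (\<Sum>i\<in>UNIV - {a}. if j = a then - of_int (c i) else if i = j then of_int (c i) else 0)"
        unfolding sum_component by (intro sum.cong) (auto simp: axis_def)
      then show "(\<Sum>i\<in>UNIV - {a}. of_int (c i) *\<^sub>R (axis i 1 - axis a (1 :: real))) $ j =
          (\<chi> i. real_of_int (if i = a then - (\<Sum>i\<in>UNIV - {a}. c i) else c i)) $ j"
        by (cases "j = a") (simp_all add: sum_negf)
    qed
    then show ?thesis
      by (simp flip: linear_cmul[OF linear_proj_along] linear_sum[OF linear_proj_along])
  qed
  show ?thesis
  proof
    assume "x \<in> rauzy_lattice L R a"
    then obtain c :: "'a \<Rightarrow> int" where c: "x = proj_along L R (\<chi> i. of_int (if i = a then - (\<Sum>i\<in>UNIV - {a}. c i) else c i))"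
      unfolding rauzy_lattice_def expand by blast
    have "(\<Sum>i\<in>UNIV. if i = a then - (\<Sum>i\<in>UNIV - {a}. c i) else c i) = 0"
      by (simp add: sum.remove[of UNIV a])
    then show "\<exists>n :: 'a \<Rightarrow> int. (\<Sum>i\<in>UNIV. n i) = 0 \<and> x = proj_along L R (\<chi> i. of_int (n i))"
      using c by blast
  next
    assume "\<exists>n :: 'a \<Rightarrow> int. (\<Sum>i\<in>UNIV. n i) = 0 \<and> x = proj_along L R (\<chi> i. of_int (n i))"
    then obtain n :: "'a \<Rightarrow> int" where n: "(\<Sum>i\<in>UNIV. n i) = 0" "x = proj_along L R (\<chi> i. of_int (n i))"
      by blast
    have "n a = - (\<Sum>i\<in>UNIV - {a}. n i)"
      using n(1) by (simp add: sum.remove[of UNIV a])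
    then have "x = proj_along L R (\<chi> i. of_int (if i = a then - (\<Sum>i\<in>UNIV - {a}. n i) else n i))"
      unfolding n(2) by (intro arg_cong[of _ _ "proj_along L R"]) (simp add: vec_eq_iff)
    then show "x \<in> rauzy_lattice L R a"
      unfolding rauzy_lattice_def expand by (rule range_eqI[where x = n])
  qed
qed

lemma rauzy_lattice_diff:
  assumes "x \<in> rauzy_lattice L R a" "y \<in> rauzy_lattice L R a"
  shows "x - y \<in> rauzy_lattice L R a"
proof -
  from assms obtain m n :: "'a \<Rightarrow> int" where
    m: "(\<Sum>i\<in>UNIV. m i) = 0" "x = proj_along L R (\<chi> i. of_int (m i))" and
    n: "(\<Sum>i\<in>UNIV. n i) = 0" "y = proj_along L R (\<chi> i. of_int (n i))"
    unfolding rauzy_lattice_iff by blast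
  have "x - y = proj_along L R (\<chi> i. of_int (m i - n i))"
    unfolding m n linear_diff[OF linear_proj_along, symmetric]
    by (rule arg_cong[of _ _ "proj_along L R"]) (simp add: vec_eq_iff)
  then show ?thesis
    unfolding rauzy_lattice_iff using m(1) n(1)
    by (intro exI[of _ "\<lambda>i. m i - n i"]) (simp add: sum_subtractf)
qed

lemma zero_in_rauzy_lattice: "0 \<in> rauzy_lattice L R a"
  unfolding rauzy_lattice_iff
  by (intro exI[of _ "\<lambda>_. 0"]) (simp add: proj_along_def vec_eq_iff inner_vec_def)

lemma rauzy_lattice_subset: "L \<bullet> R = 1 \<Longrightarrow> rauzy_lattice L R a \<subseteq> hyperplane L"
  by (auto simp: rauzy_lattice_iff proj_along_in_hyperplane)

lemma countable_rauzy_lattice: "countable (rauzy_lattice L R a)"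
  unfolding rauzy_lattice_def by (rule countable_image) simp

text \<open>The projection along \<open>R\<close> is a linear isomorphism from the vectors with coordinate sum zero onto the
  hyperplane, with inverse \<open>x \<mapsto> x - (\<Sum>\<^sub>i x\<^sub>i) R\<close> since the entries of \<open>R\<close> sum to \<open>1\<close>. The inverse takes nonzero lattice
  points to nonzero integer vectors, which have norm at least \<open>1\<close>.\<close>

lemma rauzy_lattice_discrete:
  fixes L R :: "real ^ 'a"
  assumes LR: "L \<bullet> R = 1" and R1: "(\<Sum>i\<in>UNIV. R $ i) = 1"
  obtains \<delta> where "\<delta> > 0" "\<And>x. x \<in> rauzy_lattice L R a \<Longrightarrow> x \<noteq> 0 \<Longrightarrow> \<delta> \<le> norm x"
proof -
  define \<sigma> where "\<sigma> = (\<lambda>x :: real ^ 'a. x - (\<Sum>i\<in>UNIV. x $ i) *\<^sub>R R)"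
  have "linear \<sigma>"
    by (rule linearI) (simp_all add: \<sigma>_def sum.distrib flip: sum_distrib_left, simp_all add: algebra_simps)
  then obtain K where K: "K > 0" "\<And>y. norm (\<sigma> y) \<le> K * norm y"
    using linear_bounded_pos[of \<sigma>] by (auto simp: mult.commute)
  show thesis
  proof
    show "1 / K > 0"
      using K by simp
    fix x assume x: "x \<in> rauzy_lattice L R a" "x \<noteq> 0"
    then obtain n :: "'a \<Rightarrow> int" where n: "(\<Sum>i\<in>UNIV. n i) = 0" "x = proj_along L R (\<chi> i. of_int (n i))"
      by (auto simp: rauzy_lattice_iff)
    have \<sigma>x: "\<sigma> x = (\<chi> i. of_int (n i))"
    proof -
      have "(\<Sum>i\<in>UNIV. real_of_int (n i)) = 0"
        using n(1) by (simp flip: of_int_sum)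
      then show ?thesis
        using R1 by (simp add: n(2) \<sigma>_def proj_along_def sum_subtractf flip: sum_distrib_left)
    qed
    have "\<exists>i. n i \<noteq> 0"
    proof (rule ccontr)
      assume "\<not> ?thesis"
      then have "x = proj_along L R 0"
        using n(2) by (simp add: zero_vec_def)
      then show False
        using x(2) by (simp add: proj_along_def)
    qed
    then obtain i where "n i \<noteq> 0" ..
    then have "1 \<le> \<bar>\<sigma> x $ i\<bar>"
      by (simp add: \<sigma>x)
    also have "\<dots> \<le> norm (\<sigma> x)"
      by (rule component_le_norm_cart)
    also have "\<dots> \<le> K * norm x"
      by (rule K)
    finally show "1 / K \<le> norm x"
      using K(1) by (simp add: field_simps)
  qed
qed

section \<open>Mixtures of measures and sums of extended nonnegative reals\<close>

text \<open>The common form of \<^const>\<open>expected_measure\<close>, of a finite sum of measures, and of a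
  countable sum of translates of a measure. In these three cases every set of indices is measurable,
  and then so is every kernel \<open>K\<close>.\<close>

definition mixture :: "'c measure \<Rightarrow> 'b measure \<Rightarrow> ('c \<Rightarrow> 'b measure) \<Rightarrow> 'b measure" where
  "mixture Q M K = measure_of (space M) (sets M) (\<lambda>B. \<integral>\<^sup>+ i. emeasure (K i) B \<partial>Q)"

lemma sets_mixture [simp]: "sets (mixture Q M K) = sets M"
  by (simp add: mixture_def)

lemma space_mixture [simp]: "space (mixture Q M K) = space M"
  by (simp add: mixture_def)

lemma measurable_discrete_source: "sets Q = Pow (space Q) \<Longrightarrow> f \<in> space Q \<rightarrow> space N \<Longrightarrow> f \<in> measurable Q N"
  by (auto simp: measurable_def)

lemma emeasure_mixture:
  assumes discrete: "sets Q = Pow (space Q)"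
    and K: "\<And>i. i \<in> space Q \<Longrightarrow> sets (K i) = sets M" and B: "B \<in> sets M"
  shows "emeasure (mixture Q M K) B = (\<integral>\<^sup>+ i. emeasure (K i) B \<partial>Q)"
proof (rule emeasure_measure_of[OF mixture_def])
  show "countably_additive (sets (mixture Q M K)) (\<lambda>B. \<integral>\<^sup>+ i. emeasure (K i) B \<partial>Q)"
  proof (rule countably_additiveI)
    fix A :: "nat \<Rightarrow> 'b set"
    assume A: "range A \<subseteq> sets (mixture Q M K)" "disjoint_family A"
    have "(\<Sum>n. \<integral>\<^sup>+ i. emeasure (K i) (A n) \<partial>Q) = (\<integral>\<^sup>+ i. (\<Sum>n. emeasure (K i) (A n)) \<partial>Q)"
      by (intro nn_integral_suminf[symmetric] measurable_discrete_source discrete) auto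
    also have "\<dots> = (\<integral>\<^sup>+ i. emeasure (K i) (\<Union>n. A n) \<partial>Q)"
      using A by (intro nn_integral_cong suminf_emeasure) (auto simp: K)
    finally show "(\<Sum>n. \<integral>\<^sup>+ i. emeasure (K i) (A n) \<partial>Q) = (\<integral>\<^sup>+ i. emeasure (K i) (\<Union>n. A n) \<partial>Q)" .
  qed
qed (use B sets.sets_into_space in \<open>auto simp: positive_def\<close>)

lemma nn_integral_mixture:
  assumes discrete: "sets Q = Pow (space Q)"
    and K: "\<And>i. i \<in> space Q \<Longrightarrow> sets (K i) = sets M" and f: "f \<in> borel_measurable M"
  shows "(\<integral>\<^sup>+ x. f x \<partial>mixture Q M K) = (\<integral>\<^sup>+ i. (\<integral>\<^sup>+ x. f x \<partial>K i) \<partial>Q)"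
  using f
proof (induction rule: borel_measurable_induct)
  case (cong f g)
  have "(\<integral>\<^sup>+ x. f x \<partial>mixture Q M K) = (\<integral>\<^sup>+ x. g x \<partial>mixture Q M K)"
    using cong by (intro nn_integral_cong) simp
  moreover have "(\<integral>\<^sup>+ x. f x \<partial>K i) = (\<integral>\<^sup>+ x. g x \<partial>K i)" if "i \<in> space Q" for i
    using cong sets_eq_imp_space_eq[OF K[OF that]] by (intro nn_integral_cong) simp
  ultimately show ?case
    using cong by (simp cong: nn_integral_cong)
next
  case (set A)
  then have "(\<integral>\<^sup>+ x. indicator A x \<partial>mixture Q M K) = (\<integral>\<^sup>+ i. emeasure (K i) A \<partial>Q)"
    by (simp add: emeasure_mixture[OF discrete K])
  also have "\<dots> = (\<integral>\<^sup>+ i. (\<integral>\<^sup>+ x. indicator A x \<partial>K i) \<partial>Q)"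
    using set K by (intro nn_integral_cong) simp
  finally show ?case .
next
  case (mult u c)
  have "(\<integral>\<^sup>+ x. c * u x \<partial>mixture Q M K) = c * (\<integral>\<^sup>+ x. u x \<partial>mixture Q M K)"
    using mult by (intro nn_integral_cmult) (simp cong: measurable_cong_sets)
  also have "\<dots> = (\<integral>\<^sup>+ i. c * (\<integral>\<^sup>+ x. u x \<partial>K i) \<partial>Q)"
    unfolding mult.IH by (intro nn_integral_cmult[symmetric] measurable_discrete_source discrete) simp
  also have "\<dots> = (\<integral>\<^sup>+ i. (\<integral>\<^sup>+ x. c * u x \<partial>K i) \<partial>Q)"
    using mult K by (intro nn_integral_cong nn_integral_cmult[symmetric]) (simp cong: measurable_cong_sets)
  finally show ?case .
next
  case (add u v)
  have meas: "v \<in> borel_measurable (K i)" "u \<in> borel_measurable (K i)" if "i \<in> space Q" for i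
    using add K[OF that] by (simp_all cong: measurable_cong_sets)
  have "(\<integral>\<^sup>+ x. v x + u x \<partial>mixture Q M K) = (\<integral>\<^sup>+ x. v x \<partial>mixture Q M K) + (\<integral>\<^sup>+ x. u x \<partial>mixture Q M K)"
    using add by (intro nn_integral_add) (simp_all cong: measurable_cong_sets)
  also have "\<dots> = (\<integral>\<^sup>+ i. (\<integral>\<^sup>+ x. v x \<partial>K i) + (\<integral>\<^sup>+ x. u x \<partial>K i) \<partial>Q)"
    unfolding add.IH by (intro nn_integral_add[symmetric] measurable_discrete_source discrete) simp_all
  also have "\<dots> = (\<integral>\<^sup>+ i. (\<integral>\<^sup>+ x. v x + u x \<partial>K i) \<partial>Q)"
    using meas by (intro nn_integral_cong nn_integral_add[symmetric])
  finally show ?case .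
next
  case (seq U)
  have meas: "U n \<in> borel_measurable (K i)" if "i \<in> space Q" for i n
    using seq K[OF that] by (simp cong: measurable_cong_sets)
  have "(\<integral>\<^sup>+ x. (SUP n. U n) x \<partial>mixture Q M K) = (SUP n. \<integral>\<^sup>+ x. U n x \<partial>mixture Q M K)"
    unfolding SUP_apply using seq
    by (intro nn_integral_monotone_convergence_SUP) (simp_all cong: measurable_cong_sets)
  also have "\<dots> = (\<integral>\<^sup>+ i. (SUP n. \<integral>\<^sup>+ x. U n x \<partial>K i) \<partial>Q)"
    unfolding seq.IH using \<open>incseq U\<close>
    by (intro nn_integral_monotone_convergence_SUP[symmetric] measurable_discrete_source discrete)
      (auto simp: incseq_def le_fun_def intro!: nn_integral_mono)
  also have "\<dots> = (\<integral>\<^sup>+ i. (\<integral>\<^sup>+ x. (SUP n. U n) x \<partial>K i) \<partial>Q)"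
    unfolding SUP_apply using \<open>incseq U\<close> meas
    by (intro nn_integral_cong nn_integral_monotone_convergence_SUP[symmetric])
  finally show ?case .
qed

lemma infsum_ennreal_eq_nn_integral:
  fixes f :: "'b \<Rightarrow> ennreal"
  assumes "countable A"
  shows "infsum f A = (\<integral>\<^sup>+ x. f x \<partial>count_space A)"
proof (rule antisym)
  have "sum f S \<le> (\<integral>\<^sup>+ x. f x \<partial>count_space A)" if "finite S" "S \<subseteq> A" for S
  proof -
    have "sum f S = (\<integral>\<^sup>+ x. f x * indicator S x \<partial>count_space A)"
      using that nn_integral_count_space'[of S A "\<lambda>x. f x * indicator S x"] by simp
    also have "\<dots> \<le> (\<integral>\<^sup>+ x. f x \<partial>count_space A)"
      by (intro nn_integral_mono) (simp split: split_indicator)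
    finally show ?thesis .
  qed
  then show "infsum f A \<le> (\<integral>\<^sup>+ x. f x \<partial>count_space A)"
    by (subst nonneg_infsum_complete) (auto intro!: SUP_least)
  show "(\<integral>\<^sup>+ x. f x \<partial>count_space A) \<le> infsum f A"
  proof (cases "finite A")
    case True
    then show ?thesis
      by (simp add: nn_integral_count_space_finite)
  next
    case False
    define e where "e = from_nat_into A"
    have e: "bij_betw e UNIV A"
      unfolding e_def using assms False by (rule bij_betw_from_nat_into)
    have "(\<integral>\<^sup>+ x. f x \<partial>count_space A) = (\<Sum>n. f (e n))"
      by (simp flip: nn_integral_bij_count_space[OF e] nn_integral_count_space_nat)
    also have "\<dots> = (SUP n. \<Sum>i<n. f (e i))"
      by (rule suminf_eq_SUP)
    also have "\<dots> \<le> infsum f A"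
    proof (rule SUP_least)
      fix n
      have "(\<Sum>i<n. f (e i)) = sum f (e ` {..<n})"
        using e by (subst sum.reindex) (auto simp: bij_betw_def intro: inj_on_subset)
      also have "\<dots> \<le> infsum f A"
        using e by (subst nonneg_infsum_complete) (auto simp: bij_betw_def intro!: SUP_upper)
      finally show "(\<Sum>i<n. f (e i)) \<le> infsum f A" .
    qed
    finally show ?thesis .
  qed
qed

section \<open>Lebesgue measure on a linear subspace\<close>

lemma space_borel_on [simp]: "space (borel_on H) = H"
  by (simp add: borel_on_def space_restrict_space)

lemma measurable_into_borel_on:
  "f \<in> borel_measurable M \<Longrightarrow> (\<And>x. x \<in> space M \<Longrightarrow> f x \<in> H) \<Longrightarrow> f \<in> measurable M (borel_on H)"
  unfolding borel_on_def by (rule measurable_restrict_space2) auto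

lemma measurable_inclusion_borel_on: "(\<lambda>x. x) \<in> borel_measurable (borel_on H)"
  unfolding borel_on_def by (rule measurable_restrict_space1) simp

lemma measurable_add_borel_on:
  fixes H :: "'b::euclidean_space set"
  assumes H: "subspace H" and f: "f \<in> measurable M (borel_on H)" and g: "g \<in> measurable M (borel_on H)"
  shows "(\<lambda>x. f x + g x) \<in> measurable M (borel_on H)"
proof (rule measurable_into_borel_on)
  have "f \<in> borel_measurable M" "g \<in> borel_measurable M"
    using measurable_compose[OF f measurable_inclusion_borel_on] measurable_compose[OF g measurable_inclusion_borel_on]
    by simp_all
  then show "(\<lambda>x. f x + g x) \<in> borel_measurable M"
    by simp
  show "f x + g x \<in> H" if "x \<in> space M" for x
    using measurable_space[OF f that] measurable_space[OF g that] H by (simp add: subspace_add)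
qed

text \<open>Product measures are determined by their values on boxes, and each side of a box can be
  translated separately.\<close>

lemma PiM_lborel_translate:
  fixes c :: "'i \<Rightarrow> real"
  assumes B: "finite B"
  shows "distr (\<Pi>\<^sub>M b\<in>B. lborel) (\<Pi>\<^sub>M b\<in>B. lborel) (\<lambda>f. \<lambda>b\<in>B. f b + c b) = (\<Pi>\<^sub>M b\<in>B. lborel :: real measure)"
proof -
  interpret product_sigma_finite "\<lambda>_::'i. lborel :: real measure"
    by standard
  have meas: "(\<lambda>f. \<lambda>b\<in>B. f b + c b) \<in> measurable (\<Pi>\<^sub>M b\<in>B. lborel :: real measure) (\<Pi>\<^sub>M b\<in>B. lborel)"
    by measurable
  show ?thesis
  proof (rule PiM_eqI[OF B])
    fix A :: "'i \<Rightarrow> real set" assume A: "\<And>b. b \<in> B \<Longrightarrow> A b \<in> sets lborel"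
    have "emeasure (distr (\<Pi>\<^sub>M b\<in>B. lborel) (\<Pi>\<^sub>M b\<in>B. lborel) (\<lambda>f. \<lambda>b\<in>B. f b + c b)) (Pi\<^sub>E B A)
        = emeasure (\<Pi>\<^sub>M b\<in>B. lborel) ((\<lambda>f. \<lambda>b\<in>B. f b + c b) -` Pi\<^sub>E B A \<inter> space (\<Pi>\<^sub>M b\<in>B. lborel :: real measure))"
      using A B by (intro emeasure_distr meas sets_PiM_I_finite) auto
    also have "(\<lambda>f. \<lambda>b\<in>B. f b + c b) -` Pi\<^sub>E B A \<inter> space (\<Pi>\<^sub>M b\<in>B. lborel :: real measure)
        = Pi\<^sub>E B (\<lambda>b. (+) (c b) -` A b)"
      by (auto simp: space_PiM PiE_iff add.commute)
    also have "emeasure (\<Pi>\<^sub>M b\<in>B. lborel) (Pi\<^sub>E B (\<lambda>b. (+) (c b) -` A b)) = (\<Prod>b\<in>B. emeasure lborel ((+) (c b) -` A b))"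
    proof (rule emeasure_PiM[OF B])
      fix b assume "b \<in> B"
      then show "(+) (c b) -` A b \<in> sets lborel"
        using A[of b] measurable_sets[of "(+) (c b)" lborel lborel "A b"] by simp
    qed
    also have "\<dots> = (\<Prod>b\<in>B. emeasure lborel (A b))"
    proof (rule prod.cong)
      fix b assume "b \<in> B"
      then have "emeasure (distr lborel borel ((+) (c b))) (A b) = emeasure lborel ((+) (c b) -` A b)"
        using A[of b] by (subst emeasure_distr) auto
      then show "emeasure lborel ((+) (c b) -` A b) = emeasure lborel (A b)"
        by (simp add: lborel_distr_plus)
    qed simp
    finally show "emeasure (distr (\<Pi>\<^sub>M b\<in>B. lborel) (\<Pi>\<^sub>M b\<in>B. lborel) (\<lambda>f. \<lambda>b\<in>B. f b + c b)) (Pi\<^sub>E B A)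
        = (\<Prod>b\<in>B. emeasure lborel (A b))" .
  qed simp
qed

text \<open>Fixes one orthonormal basis in the definition of \<^const>\<open>subspace_lborel\<close>, so that the measure
  can be computed in coordinates.\<close>

lemma subspace_lborel_basis:
  fixes H :: "'b::euclidean_space set"
  assumes "subspace H"
  obtains B where "finite B" "B \<subseteq> H" "\<And>b c. b \<in> B \<Longrightarrow> c \<in> B \<Longrightarrow> b \<bullet> c = (if b = c then 1 else 0)"
    "\<And>x. x \<in> H \<Longrightarrow> (\<Sum>b\<in>B. (x \<bullet> b) *\<^sub>R b) = x"
    "subspace_lborel H = distr (\<Pi>\<^sub>M b\<in>B. lborel) (borel_on H) (\<lambda>f. \<Sum>b\<in>B. f b *\<^sub>R b)"
proof -
  let ?orthonormal = "\<lambda>B. pairwise orthogonal B \<and> (\<forall>b\<in>B. norm b = 1) \<and> span B = H"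
  define B where "B = (SOME B. ?orthonormal B)"
  have "\<exists>B. ?orthonormal B"
    using orthonormal_basis_subspace[OF assms] by metis
  then have B: "?orthonormal B"
    unfolding B_def by (rule someI_ex)
  have fin: "finite B"
    using pairwise_orthogonal_imp_finite B by blast
  have inner: "b \<bullet> c = (if b = c then 1 else 0)" if "b \<in> B" "c \<in> B" for b c
    using B that by (auto simp: pairwise_def orthogonal_def dot_square_norm)
  have "(\<Sum>b\<in>B. (x \<bullet> b) *\<^sub>R b) = x" if "x \<in> H" for x
  proof -
    have "x \<in> span B"
      using B that by simp
    then obtain u where u: "x = (\<Sum>b\<in>B. u b *\<^sub>R b)"
      using span_finite[OF fin] by auto
    have "x \<bullet> c = u c" if "c \<in> B" for c
      using fin that unfolding u inner_sum_left
      by (simp add: inner if_distrib[of "\<lambda>t. _ * t"] cong: sum.cong if_cong)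
    then have "(\<Sum>b\<in>B. (x \<bullet> b) *\<^sub>R b) = (\<Sum>b\<in>B. u b *\<^sub>R b)"
      by (intro sum.cong) auto
    then show ?thesis
      using u by simp
  qed
  moreover have "B \<subseteq> H"
    using B span_superset by blast
  ultimately show thesis
    using fin inner by (intro that[of B]) (simp_all add: subspace_lborel_def Let_def flip: B_def)
qed

lemma sets_subspace_lborel [simp]: "sets (subspace_lborel H) = sets (borel_on H)"
  by (simp add: subspace_lborel_def Let_def)

lemma space_subspace_lborel [simp]: "space (subspace_lborel H) = H"
  by (simp add: subspace_lborel_def Let_def)

lemma measurable_coordinates_to_subspace:
  fixes H :: "'b::euclidean_space set"
  assumes "subspace H" "finite B" "B \<subseteq> H"
  shows "(\<lambda>f. \<Sum>b\<in>B. f b *\<^sub>R b) \<in> measurable (\<Pi>\<^sub>M b\<in>B. lborel) (borel_on H)"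
proof (rule measurable_into_borel_on)
  show "(\<lambda>f. \<Sum>b\<in>B. f b *\<^sub>R b) \<in> borel_measurable (\<Pi>\<^sub>M b\<in>B. lborel)"
    by measurable
  show "(\<Sum>b\<in>B. f b *\<^sub>R b) \<in> H" for f
    using assms by (auto intro!: subspace_sum subspace_scale)
qed

lemma emeasure_subspace_lborel_translate:
  fixes H :: "'b::euclidean_space set"
  assumes H: "subspace H" and h: "h \<in> H" and A: "A \<in> sets (borel_on H)"
  shows "emeasure (subspace_lborel H) {x\<in>H. x + h \<in> A} = emeasure (subspace_lborel H) A"
proof -
  obtain B where B: "finite B" "B \<subseteq> H"
    and expand: "\<And>x. x \<in> H \<Longrightarrow> (\<Sum>b\<in>B. (x \<bullet> b) *\<^sub>R b) = x"
    and leb: "subspace_lborel H = distr (\<Pi>\<^sub>M b\<in>B. lborel) (borel_on H) (\<lambda>f. \<Sum>b\<in>B. f b *\<^sub>R b)"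
    by (rule subspace_lborel_basis[OF H]) blast
  let ?P = "\<Pi>\<^sub>M b\<in>B. lborel :: real measure"
  let ?T = "\<lambda>f. \<Sum>b\<in>B. f b *\<^sub>R b"
  let ?S = "\<lambda>f. \<lambda>b\<in>B. f b + h \<bullet> b"
  note T = measurable_coordinates_to_subspace[OF H B]
  have S: "?S \<in> measurable ?P ?P"
    by measurable
  have shift: "(\<lambda>x. x + h) \<in> measurable (borel_on H) (borel_on H)"
    using measurable_add_borel_on[OF H, of "\<lambda>x. x" _ "\<lambda>x. h"] h by simp
  have "?T (?S f) = ?T f + h" for f
    using expand[OF h] by (simp add: scaleR_add_left sum.distrib)
  then have comm: "(\<lambda>x. x + h) \<circ> ?T = ?T \<circ> ?S"
    by auto
  have "distr (subspace_lborel H) (borel_on H) (\<lambda>x. x + h) = distr (distr ?P ?P ?S) (borel_on H) ?T"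
    unfolding leb distr_distr[OF shift T] distr_distr[OF T S] comm ..
  then have "distr (subspace_lborel H) (borel_on H) (\<lambda>x. x + h) = subspace_lborel H"
    by (simp add: PiM_lborel_translate[OF B(1)] leb)
  moreover have "emeasure (distr (subspace_lborel H) (borel_on H) (\<lambda>x. x + h)) A =
      emeasure (subspace_lborel H) {x\<in>H. x + h \<in> A}"
    using A shift by (subst emeasure_distr) (auto simp: vimage_def Int_def conj_commute cong: measurable_cong_sets)
  ultimately show ?thesis
    by simp
qed

lemma emeasure_subspace_lborel_bounded:
  fixes H :: "'b::euclidean_space set"
  assumes H: "subspace H" and bdd: "bounded A"
  shows "emeasure (subspace_lborel H) A < \<infinity>"
proof (cases "A \<in> sets (borel_on H)")
  case False
  then show ?thesis
    by (simp add: emeasure_notin_sets)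
next
  case True
  obtain B where B: "finite B" "B \<subseteq> H"
    and inner: "\<And>b c. b \<in> B \<Longrightarrow> c \<in> B \<Longrightarrow> b \<bullet> c = (if b = c then 1 else 0)"
    and leb: "subspace_lborel H = distr (\<Pi>\<^sub>M b\<in>B. lborel) (borel_on H) (\<lambda>f. \<Sum>b\<in>B. f b *\<^sub>R b)"
    by (rule subspace_lborel_basis[OF H]) blast
  interpret product_sigma_finite "\<lambda>_::'b. lborel :: real measure"
    by standard
  let ?T = "\<lambda>f. \<Sum>b\<in>B. f b *\<^sub>R b"
  note T = measurable_coordinates_to_subspace[OF H B]
  obtain r where r: "\<And>x. x \<in> A \<Longrightarrow> norm x \<le> r"
    using bdd by (auto simp: bounded_iff)
  have coord: "\<bar>f c\<bar> \<le> r" if "?T f \<in> A" "c \<in> B" for f c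
  proof -
    have "?T f \<bullet> c = f c"
      using B(1) that(2) unfolding inner_sum_left
      by (simp add: inner if_distrib[of "\<lambda>t. _ * t"] cong: sum.cong if_cong)
    moreover have "\<bar>?T f \<bullet> c\<bar> \<le> norm (?T f) * norm c"
      by (rule Cauchy_Schwarz_ineq2)
    moreover have "norm c = 1"
      using inner[OF that(2) that(2)] by (simp add: norm_eq_sqrt_inner)
    ultimately show ?thesis
      using r[OF that(1)] by simp
  qed
  have "emeasure (subspace_lborel H) A = emeasure (\<Pi>\<^sub>M b\<in>B. lborel) (?T -` A \<inter> space (\<Pi>\<^sub>M b\<in>B. lborel :: real measure))"
    unfolding leb by (rule emeasure_distr[OF T True])
  also have "\<dots> \<le> emeasure (\<Pi>\<^sub>M b\<in>B. lborel) (Pi\<^sub>E B (\<lambda>_. {- r..r}))"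
  proof (rule emeasure_mono)
    show "?T -` A \<inter> space (\<Pi>\<^sub>M b\<in>B. lborel :: real measure) \<subseteq> Pi\<^sub>E B (\<lambda>_. {- r..r})"
      using coord by (auto simp: space_PiM PiE_iff abs_le_iff minus_le_iff)
  qed (simp add: B(1) sets_PiM_I_finite)
  also have "\<dots> = (\<Prod>b\<in>B. emeasure lborel {- r..r})"
    by (rule emeasure_PiM[OF B(1)]) simp
  also have "\<dots> < \<infinity>"
    by (simp add: less_top[symmetric] ennreal_prod_eq_top emeasure_lborel_Icc_eq del: prod_constant)
  finally show ?thesis .
qed

lemma emeasure_subspace_lborel_space_nonzero:
  fixes H :: "'b::euclidean_space set"
  assumes H: "subspace H"
  shows "emeasure (subspace_lborel H) H \<noteq> 0"
proof -
  obtain B where B: "finite B" "B \<subseteq> H"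
    and leb: "subspace_lborel H = distr (\<Pi>\<^sub>M b\<in>B. lborel) (borel_on H) (\<lambda>f. \<Sum>b\<in>B. f b *\<^sub>R b)"
    by (rule subspace_lborel_basis[OF H]) blast
  interpret product_sigma_finite "\<lambda>_::'b. lborel :: real measure"
    by standard
  note T = measurable_coordinates_to_subspace[OF H B]
  have "emeasure (subspace_lborel H) H =
      emeasure (\<Pi>\<^sub>M b\<in>B. lborel) (space (\<Pi>\<^sub>M b\<in>B. lborel :: real measure))"
    unfolding leb using measurable_space[OF T] sets.top[of "borel_on H"]
    by (subst emeasure_distr[OF T]) (auto intro!: arg_cong[where f = "emeasure _"])
  also have "\<dots> = (\<Prod>b\<in>B. emeasure lborel (UNIV :: real set))"
    unfolding space_PiM by (subst emeasure_PiM[OF B(1)]) simp_all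
  finally show ?thesis
    by (simp add: B(1))
qed

lemma sigma_finite_subspace_lborel:
  fixes H :: "'b::euclidean_space set"
  assumes H: "subspace H"
  shows "sigma_finite_measure (subspace_lborel H)"
proof
  let ?A = "range (\<lambda>n::nat. H \<inter> ball 0 (real n))"
  have "H \<inter> ball 0 (real n) \<in> sets (borel_on H)" for n
    by (auto simp: borel_on_def sets_restrict_space)
  moreover have "\<Union>?A = H"
    by (auto simp: reals_Archimedean2)
  moreover have "emeasure (subspace_lborel H) (H \<inter> ball 0 (real n)) \<noteq> \<infinity>" for n
    using emeasure_subspace_lborel_bounded[OF H, of "H \<inter> ball 0 (real n)"]
    by (simp add: less_top bounded_Int)
  ultimately show "\<exists>A. countable A \<and> A \<subseteq> sets (subspace_lborel H) \<and> \<Union>A = space (subspace_lborel H) \<and>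
      (\<forall>a\<in>A. emeasure (subspace_lborel H) a \<noteq> \<infinity>)"
    by (intro exI[of _ ?A]) auto
qed

section \<open>Periodisation of a measure along a lattice\<close>

text \<open>A discrete subgroup \<open>J\<close> of a linear subspace \<open>H\<close>; \<open>\<delta>\<close> bounds the distance of
  distinct points of \<open>J\<close> from below.\<close>

locale subspace_lattice =
  fixes H J :: "'b::euclidean_space set" and \<delta> :: real
  assumes subspace: "subspace H" and J_subset: "J \<subseteq> H" and countable_J: "countable J"
    and zero_J: "0 \<in> J" and diff_J: "\<And>x y. x \<in> J \<Longrightarrow> y \<in> J \<Longrightarrow> x - y \<in> J"
    and \<delta>_pos: "\<delta> > 0" and separated: "\<And>x. x \<in> J \<Longrightarrow> x \<noteq> 0 \<Longrightarrow> \<delta> \<le> norm x"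
begin

abbreviation "leb \<equiv> subspace_lborel H"

definition periodic :: "'b set \<Rightarrow> bool" where
  "periodic C \<longleftrightarrow> C \<in> sets (borel_on H) \<and> (\<forall>x\<in>C. \<forall>j\<in>J. x + j \<in> C)"

text \<open>A fundamental domain of the action of \<open>J\<close> on a set \<open>C\<close>, except that \<open>F\<close> may stick out
  of \<open>C\<close>. The dependence on \<open>C\<close> allows one to compare a fundamental domain of the whole subspace with a
  small open set, which is a fundamental domain of its own saturation only.\<close>

definition transversal :: "'b set \<Rightarrow> 'b set \<Rightarrow> bool" where
  "transversal C F \<longleftrightarrow> F \<in> sets (borel_on H) \<and> (\<forall>x\<in>C. \<exists>!j. j \<in> J \<and> x - j \<in> F)"

lemma minus_J: "j \<in> J \<Longrightarrow> - j \<in> J"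
  using diff_J[OF zero_J, of j] by simp

lemma add_J: "i \<in> J \<Longrightarrow> j \<in> J \<Longrightarrow> i + j \<in> J"
  using diff_J[of i "- j"] minus_J[of j] by simp

lemma sets_subset_H: "A \<in> sets (borel_on H) \<Longrightarrow> A \<subseteq> H"
  using sets.sets_into_space[of A "borel_on H"] by simp

lemma sets_translate [intro]:
  assumes h: "h \<in> H" and A: "A \<in> sets (borel_on H)"
  shows "{x\<in>H. x + h \<in> A} \<in> sets (borel_on H)"
proof -
  have "(\<lambda>x. x + h) \<in> measurable (borel_on H) (borel_on H)"
    using measurable_add_borel_on[OF subspace, of "\<lambda>x. x" _ "\<lambda>x. h"] h by simp
  from measurable_sets[OF this A] show ?thesis
    by (simp add: vimage_def Int_def conj_commute)
qed

lemma sets_translate_minus [intro]: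
  assumes "h \<in> H" "A \<in> sets (borel_on H)"
  shows "{x\<in>H. x - h \<in> A} \<in> sets (borel_on H)"
  using sets_translate[of "- h" A] assms subspace by (simp add: subspace_neg)

lemma periodic_minus: "periodic C \<Longrightarrow> x \<in> C \<Longrightarrow> j \<in> J \<Longrightarrow> x - j \<in> C"
  using minus_J[of j] unfolding periodic_def by (metis diff_conv_add_uminus)

text \<open>Cutting \<open>C \<inter> G\<close> along the translates of \<open>F\<close> and moving the pieces back by elements of \<open>J\<close>
  reassembles them to \<open>C \<inter> F\<close>.\<close>

lemma emeasure_transversal_eq:
  assumes C: "periodic C" and F: "transversal C F" and G: "transversal C G"
  shows "emeasure leb (C \<inter> F) = emeasure leb (C \<inter> G)"
proof -
  have C_sets: "C \<in> sets (borel_on H)" and F_sets: "F \<in> sets (borel_on H)" and G_sets: "G \<in> sets (borel_on H)"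
    using C F G by (auto simp: periodic_def transversal_def)
  have CH: "C \<subseteq> H"
    using C_sets by (rule sets_subset_H)
  (* ?X j is the part of C \<inter> G in the translate of F by j, and ?Y j is ?X j moved back by j. *)
  let ?X = "\<lambda>j. C \<inter> G \<inter> {x\<in>H. x + (- j) \<in> F}"
  let ?Y = "\<lambda>j. C \<inter> F \<inter> {x\<in>H. x + j \<in> G}"
  have in_H: "j \<in> H" "- j \<in> H" if "j \<in> J" for j
    using that J_subset minus_J by auto
  have X_sets: "?X j \<in> sets (borel_on H)" and Y_sets: "?Y j \<in> sets (borel_on H)" if "j \<in> J" for j
    using in_H[OF that] C_sets F_sets G_sets by auto
  have "C \<inter> G = (\<Union>j\<in>J. ?X j)"
    using F CH by (fastforce simp: transversal_def)
  moreover have "disjoint_family_on ?X J"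
    using F by (fastforce simp: transversal_def disjoint_family_on_def)
  ultimately have "emeasure leb (C \<inter> G) = (\<integral>\<^sup>+ j. emeasure leb (?X j) \<partial>count_space J)"
    using emeasure_UN_countable[of J ?X leb] X_sets countable_J by simp
  also have "\<dots> = (\<integral>\<^sup>+ j. emeasure leb (?Y j) \<partial>count_space J)"
  proof (rule nn_integral_cong)
    fix j assume "j \<in> space (count_space J)"
    then have j: "j \<in> J"
      by simp
    have "{x\<in>H. x + j \<in> ?X j} = ?Y j"
      using periodic_minus[OF C _ j] CH in_H[OF j] subspace_add[OF subspace _ in_H(1)[OF j]] C j
      by (auto simp: periodic_def) (metis add_diff_cancel)
    then show "emeasure leb (?X j) = emeasure leb (?Y j)"
      using emeasure_subspace_lborel_translate[OF subspace in_H(1)[OF j] X_sets[OF j]] by simp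
  qed
  also have "\<dots> = emeasure leb (\<Union>j\<in>J. ?Y j)"
  proof (rule emeasure_UN_countable[symmetric])
    show "disjoint_family_on ?Y J"
      unfolding disjoint_family_on_def
    proof (intro ballI impI, rule ccontr)
      fix i j assume ij: "i \<in> J" "j \<in> J" "i \<noteq> j" and "?Y i \<inter> ?Y j \<noteq> {}"
      then obtain x where x: "x \<in> C" "x - (- i) \<in> G" "x - (- j) \<in> G"
        by auto
      then have "- i = - j"
        using G minus_J[OF ij(1)] minus_J[OF ij(2)] unfolding transversal_def by blast
      then show False
        using ij by simp
    qed
  qed (use Y_sets countable_J in auto)
  also have "(\<Union>j\<in>J. ?Y j) = C \<inter> F"
  proof
    show "C \<inter> F \<subseteq> (\<Union>j\<in>J. ?Y j)"
    proof
      fix x assume x: "x \<in> C \<inter> F"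
      then obtain j where "j \<in> J" "x - j \<in> G"
        using G unfolding transversal_def by blast
      then show "x \<in> (\<Union>j\<in>J. ?Y j)"
        using x CH minus_J[of j] by (auto intro!: bexI[of _ "- j"])
    qed
  qed auto
  finally show ?thesis
    by simp
qed

lemma transversal_subset: "transversal H F \<Longrightarrow> C \<subseteq> H \<Longrightarrow> transversal C F"
  by (auto simp: transversal_def)

lemma transversal_translate:
  assumes F: "transversal H F" and y: "y \<in> H"
  shows "transversal H {x\<in>H. x - y \<in> F}"
  unfolding transversal_def
proof (intro conjI ballI)
  show "{x\<in>H. x - y \<in> F} \<in> sets (borel_on H)"
    using F y by (auto simp: transversal_def)
  fix x assume x: "x \<in> H"
  have "x - y \<in> H"
    using x y subspace by (simp add: subspace_diff)
  moreover have "x - j \<in> H" if "j \<in> J" for j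
    using x that J_subset subspace by (auto simp: subspace_diff)
  moreover have "x - j - y = x - y - j" for j
    by simp
  ultimately show "\<exists>!j. j \<in> J \<and> x - j \<in> {x\<in>H. x - y \<in> F}"
    using F unfolding transversal_def by (metis (no_types, lifting) mem_Collect_eq)
qed

text \<open>Integrating the constant \<open>h \<mapsto> m (C - h)\<close> over \<open>F\<close> gives the left-hand side. Exchanging the order of integration,
  the inner integral becomes the Lebesgue measure of the part of \<open>C\<close> in a translate of \<open>F\<close>;
  this translate is again a fundamental domain, so the inner integral is constant as well.\<close>

lemma emeasure_periodic_eq:
  assumes m: "finite_measure m" "sets m = sets (borel_on H)"
    and C: "periodic C" and F: "transversal H F"
    and inv: "\<And>h. h \<in> H \<Longrightarrow> emeasure m {x\<in>H. x + h \<in> C} = emeasure m C"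
  shows "emeasure leb F * emeasure m C = emeasure leb (C \<inter> F) * emeasure m H"
proof -
  interpret m: finite_measure m by fact
  interpret leb: sigma_finite_measure leb
    by (rule sigma_finite_subspace_lborel[OF subspace])
  interpret pair_sigma_finite leb m ..
  have space_m: "space m = H"
    using sets_eq_imp_space_eq[OF m(2)] by simp
  have C_sets: "C \<in> sets (borel_on H)" and F_sets: "F \<in> sets (borel_on H)"
    using C F by (auto simp: periodic_def transversal_def)
  have CH: "C \<subseteq> H" and FH: "F \<subseteq> H"
    using C_sets F_sets by (simp_all add: sets_subset_H)
  define S where "S = {(h, x). h \<in> F \<and> x \<in> H \<and> x + h \<in> C}"
  have plus: "(\<lambda>(h, x). x + h) \<in> measurable (leb \<Otimes>\<^sub>M m) (borel_on H)"
    unfolding case_prod_beta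
    by (intro measurable_add_borel_on[OF subspace])
      (use m(2) in \<open>simp_all cong: measurable_cong_sets\<close>)
  have "S = (F \<times> H) \<inter> ((\<lambda>(h, x). x + h) -` C \<inter> space (leb \<Otimes>\<^sub>M m))"
    using FH by (auto simp: S_def space_pair_measure space_m)
  moreover have "F \<times> H \<in> sets (leb \<Otimes>\<^sub>M m)"
    using F_sets sets.top[of m] by (intro pair_measureI) (simp_all add: space_m)
  ultimately have S: "S \<in> sets (leb \<Otimes>\<^sub>M m)"
    using measurable_sets[OF plus C_sets] by simp
  have "emeasure (leb \<Otimes>\<^sub>M m) S = (\<integral>\<^sup>+ h. emeasure m (Pair h -` S) \<partial>leb)"
    by (rule m.emeasure_pair_measure_alt[OF S])
  also have "\<dots> = (\<integral>\<^sup>+ h. emeasure m C * indicator F h \<partial>leb)"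
  proof (rule nn_integral_cong)
    fix h
    have "Pair h -` S = (if h \<in> F then {x\<in>H. x + h \<in> C} else {})"
      by (auto simp: S_def)
    then show "emeasure m (Pair h -` S) = emeasure m C * indicator F h"
      using inv[of h] FH by auto
  qed
  also have "\<dots> = emeasure leb F * emeasure m C"
    using F_sets by (subst nn_integral_cmult_indicator) (simp_all add: mult.commute)
  finally have "emeasure (leb \<Otimes>\<^sub>M m) S = emeasure leb F * emeasure m C" .
  moreover have "emeasure (leb \<Otimes>\<^sub>M m) S = (\<integral>\<^sup>+ x. emeasure leb ((\<lambda>h. (h, x)) -` S) \<partial>m)"
    by (rule emeasure_pair_measure_alt2[OF S])
  also have "\<dots> = (\<integral>\<^sup>+ x. emeasure leb (C \<inter> F) \<partial>m)"
  proof (rule nn_integral_cong)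
    fix x assume "x \<in> space m"
    then have x: "x \<in> H"
      by (simp add: space_m)
    note Fx = transversal_translate[OF F x]
    have "(\<lambda>h. (h, x)) -` S = {h\<in>H. h + x \<in> C \<inter> {y\<in>H. y - x \<in> F}}"
      using x FH CH by (auto simp: S_def add.commute)
    moreover have "C \<inter> {y\<in>H. y - x \<in> F} \<in> sets (borel_on H)"
      using C_sets Fx unfolding transversal_def by (intro sets.Int) blast+
    ultimately have "emeasure leb ((\<lambda>h. (h, x)) -` S) = emeasure leb (C \<inter> {y\<in>H. y - x \<in> F})"
      using emeasure_subspace_lborel_translate[OF subspace x] by presburger
    also have "\<dots> = emeasure leb (C \<inter> F)"
      by (intro emeasure_transversal_eq[OF C] transversal_subset[OF _ CH] Fx F)
    finally show "emeasure leb ((\<lambda>h. (h, x)) -` S) = emeasure leb (C \<inter> F)" .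
  qed
  also have "\<dots> = emeasure leb (C \<inter> F) * emeasure m H"
    by (simp add: space_m)
  finally show ?thesis
    using \<open>emeasure (leb \<Otimes>\<^sub>M m) S = emeasure leb F * emeasure m C\<close> by simp
qed

text \<open>Relatively open sets of diameter so small that distinct \<open>J\<close>-translates are disjoint.\<close>

definition small_open :: "'b set \<Rightarrow> bool" where
  "small_open U \<longleftrightarrow> (\<exists>V. open V \<and> U = H \<inter> V) \<and> (\<forall>x\<in>U. \<forall>y\<in>U. norm (x - y) < \<delta>)"

definition saturation :: "'b set \<Rightarrow> 'b set" where
  "saturation U = {x\<in>H. \<exists>j\<in>J. x - j \<in> U}"

lemma sets_relatively_open: "open V \<Longrightarrow> H \<inter> V \<in> sets (borel_on H)"
  by (auto simp: borel_on_def sets_restrict_space)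

lemma saturation_open:
  assumes "open V"
  shows "saturation (H \<inter> V) = H \<inter> (\<Union>j\<in>J. (+) j ` V)"
proof -
  have "x - j \<in> H" if "x \<in> H" "j \<in> J" for x j
    using that J_subset subspace by (auto simp: subspace_diff)
  then show ?thesis
    by (auto simp: saturation_def image_iff) (metis add_diff_cancel_left' diff_add_cancel add.commute)+
qed

lemma periodic_saturation:
  assumes V: "open V"
  shows "periodic (saturation (H \<inter> V))"
  unfolding periodic_def
proof (intro conjI ballI)
  show "saturation (H \<inter> V) \<in> sets (borel_on H)"
    unfolding saturation_open[OF V] using V by (intro sets_relatively_open) (auto intro: open_translation)
  fix x j assume x: "x \<in> saturation (H \<inter> V)" and j: "j \<in> J"
  then obtain i where "i \<in> J" "x - i \<in> H \<inter> V" "x \<in> H"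
    by (auto simp: saturation_def)
  moreover have "x + j \<in> H"
    using \<open>x \<in> H\<close> j J_subset subspace by (auto simp: subspace_add)
  ultimately show "x + j \<in> saturation (H \<inter> V)"
    using add_J[OF \<open>i \<in> J\<close> j] by (auto simp: saturation_def intro!: bexI[of _ "i + j"])
qed

lemma unique_translate:
  assumes "small_open U" "i \<in> J" "j \<in> J" "x - i \<in> U" "x - j \<in> U"
  shows "i = j"
proof (rule ccontr)
  assume "i \<noteq> j"
  then have "\<delta> \<le> norm (i - j)"
    using assms diff_J by (intro separated) auto
  moreover have "norm ((x - j) - (x - i)) < \<delta>"
    using assms unfolding small_open_def by blast
  ultimately show False
    by simp
qed

lemma transversal_saturation: "small_open U \<Longrightarrow> transversal (saturation U) U"
  using unique_translate[of U] sets_relatively_open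
  by (auto simp: transversal_def saturation_def small_open_def)

definition periodisation :: "'b measure \<Rightarrow> 'b measure" where
  "periodisation m = mixture (count_space J) (borel_on H) (\<lambda>j. distr m (borel_on H) (\<lambda>x. x + j))"

lemma emeasure_distr_translate:
  assumes m: "sets m = sets (borel_on H)" and j: "j \<in> H" and B: "B \<in> sets (borel_on H)"
  shows "emeasure (distr m (borel_on H) (\<lambda>x. x + j)) B = emeasure m {x\<in>H. x + j \<in> B}"
proof (subst emeasure_distr[OF _ B])
  show "(\<lambda>x. x + j) \<in> measurable m (borel_on H)"
    using measurable_add_borel_on[OF subspace, of "\<lambda>x. x" m "\<lambda>x. j"] j m
    by (auto cong: measurable_cong_sets)
qed (use sets_eq_imp_space_eq[OF m] in \<open>simp add: vimage_def Int_def conj_commute\<close>)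

lemma emeasure_periodisation:
  assumes m: "sets m = sets (borel_on H)" and B: "B \<in> sets (borel_on H)"
  shows "emeasure (periodisation m) B = (\<integral>\<^sup>+ j. emeasure m {x\<in>H. x + j \<in> B} \<partial>count_space J)"
  using B emeasure_distr_translate[OF m _ B] J_subset
  by (auto simp: periodisation_def emeasure_mixture intro!: nn_integral_cong)

text \<open>The translates of a small set are disjoint, so summing their measures measures the
  saturation.\<close>

lemma emeasure_periodisation_small:
  assumes m: "sets m = sets (borel_on H)" and U: "small_open U"
  shows "emeasure (periodisation m) U = emeasure m (saturation U)"
proof -
  have U_sets: "U \<in> sets (borel_on H)"
    using transversal_saturation[OF U] by (simp add: transversal_def)
  let ?X = "\<lambda>j. {x\<in>H. x + (- j) \<in> U}"
  have "saturation U = (\<Union>j\<in>J. ?X j)"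
    by (auto simp: saturation_def)
  moreover have "disjoint_family_on ?X J"
    using unique_translate[OF U] by (auto simp: disjoint_family_on_def)
  moreover have "?X j \<in> sets m" if "j \<in> J" for j
    unfolding m using that minus_J J_subset U_sets by auto
  ultimately have "emeasure m (saturation U) = (\<integral>\<^sup>+ j. emeasure m (?X j) \<partial>count_space J)"
    using emeasure_UN_countable[of J ?X m] countable_J by simp
  also have "\<dots> = (\<integral>\<^sup>+ j. emeasure m {x\<in>H. x + j \<in> U} \<partial>count_space J)"
  proof -
    have "bij_betw uminus J J"
      by (rule bij_betw_byWitness[where f' = uminus]) (use minus_J in auto)
    from nn_integral_bij_count_space[OF this, of "\<lambda>j. emeasure m {x\<in>H. x + j \<in> U}"] show ?thesis
      by simp
  qed
  finally show ?thesis
    using emeasure_periodisation[OF m U_sets] by simp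
qed

text \<open>The members of a countable basis of the topology that have small diameter still form a
  basis.\<close>

lemma small_open_generates:
  obtains \<B> where "countable \<B>" "\<And>U. U \<in> \<B> \<Longrightarrow> small_open U" "\<Union>\<B> = H"
    "sets (borel_on H) = sigma_sets H {U. small_open U}"
proof -
  obtain \<O> :: "'b set set" where \<O>: "countable \<O>" "topological_basis \<O>"
    using ex_countable_basis by blast
  define \<S> where "\<S> = {b\<in>\<O>. \<forall>x\<in>b. \<forall>y\<in>b. norm (x - y) < \<delta>}"
  have small: "small_open (H \<inter> b)" if "b \<in> \<S>" for b
    using that topological_basis_open[OF \<O>(2)] unfolding small_open_def \<S>_def by blast
  have basis: "\<exists>b\<in>\<S>. x \<in> b \<and> b \<subseteq> V" if "open V" "x \<in> V" for x V
  proof -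
    have "open (V \<inter> ball x (\<delta> / 2))" "x \<in> V \<inter> ball x (\<delta> / 2)"
      using that \<delta>_pos by auto
    then obtain b where b: "b \<in> \<O>" "x \<in> b" "b \<subseteq> V \<inter> ball x (\<delta> / 2)"
      using topological_basisE[OF \<O>(2)] by metis
    have "norm (y - z) < \<delta>" if "y \<in> b" "z \<in> b" for y z
    proof -
      have "dist x y < \<delta> / 2" "dist x z < \<delta> / 2"
        using b(3) that by auto
      then have "dist y z < \<delta>"
        by (rule dist_triangle_half_r)
      then show ?thesis
        by (simp add: dist_norm)
    qed
    then show ?thesis
      using b by (auto simp: \<S>_def)
  qed
  have countable: "countable \<S>"
    using \<O>(1) by (rule countable_subset[rotated]) (auto simp: \<S>_def)
  show thesis
  proof (rule that[of "(\<inter>) H ` \<S>"])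
    show "countable ((\<inter>) H ` \<S>)"
      using countable by simp
    show "\<Union>((\<inter>) H ` \<S>) = H"
      using basis[of UNIV] by auto
    show "sets (borel_on H) = sigma_sets H {U. small_open U}"
    proof -
      have "sets (borel_on H) = (\<inter>) H ` sigma_sets UNIV {S. open S}"
        by (simp add: borel_on_def sets_restrict_space borel_def)
      also have "\<dots> = sigma_sets H ((\<inter>) H ` {S. open S})"
        using borel_closed[OF closed_subspace[OF subspace]]
        by (intro sigma_sets_Int) (simp_all add: borel_def)
      also have "\<dots> = sigma_sets H {U. small_open U}"
      proof (rule sigma_sets_eqI)
        fix A assume "A \<in> (\<inter>) H ` {S. open S}"
        then obtain V where V: "open V" "A = H \<inter> V"
          by auto
        have "A = \<Union>((\<inter>) H ` {b\<in>\<S>. b \<subseteq> V})"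
          using basis[OF V(1)] V(2) by fastforce
        moreover have "\<Union>((\<inter>) H ` {b\<in>\<S>. b \<subseteq> V}) \<in> sigma_sets H {U. small_open U}"
          using countable small
          by (intro sigma_sets_UNION countable_image) (auto intro: countable_subset)
        ultimately show "A \<in> sigma_sets H {U. small_open U}"
          by simp
      next
        fix U assume "U \<in> {U. small_open U}"
        then show "U \<in> sigma_sets H ((\<inter>) H ` {S. open S})"
          by (auto simp: small_open_def)
      qed
      finally show ?thesis .
    qed
  qed (use small in auto)
qed

text \<open>Saturations of open sets suffice for the invariance hypothesis because the measures are compared
  on small open sets only. The comparison there also shows that the Lebesgue measure of \<open>F\<close> is
  neither \<open>0\<close> nor infinite: otherwise Lebesgue measure, respectively \<open>m\<close>, would vanish on a
  countable cover by small sets.\<close>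

theorem periodisation_eq_lebesgue:
  assumes m: "sets m = sets (borel_on H)" "emeasure m H = 1"
    and F: "transversal H F"
    and inv: "\<And>V h. open V \<Longrightarrow> h \<in> H \<Longrightarrow>
      emeasure m {x\<in>H. x + h \<in> saturation (H \<inter> V)} = emeasure m (saturation (H \<inter> V))"
  shows "periodisation m = scale_measure (1 / emeasure leb F) leb"
proof -
  have space_m: "space m = H"
    using sets_eq_imp_space_eq[OF m(1)] by simp
  interpret m: finite_measure m
    by standard (simp add: space_m m(2))
  obtain \<B> where \<B>: "countable \<B>" "\<And>U. U \<in> \<B> \<Longrightarrow> small_open U" "\<Union>\<B> = H"
    and gen: "sets (borel_on H) = sigma_sets H {U. small_open U}"
    by (rule small_open_generates) blast
  have small_sets: "U \<in> sets (borel_on H)" if "small_open U" for U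
    using transversal_saturation[OF that] by (simp add: transversal_def)
  have key: "emeasure leb F * emeasure m (saturation U) = emeasure leb U" if U: "small_open U" for U
  proof -
    obtain V where V: "open V" "U = H \<inter> V"
      using U by (auto simp: small_open_def)
    have per: "periodic (saturation U)"
      unfolding V(2) by (rule periodic_saturation[OF V(1)])
    have sub: "saturation U \<subseteq> H" and "U \<subseteq> saturation U"
      using zero_J V(2) by (auto simp: saturation_def intro!: bexI[of _ 0])
    have "emeasure leb F * emeasure m (saturation U) = emeasure leb (saturation U \<inter> F)"
      using emeasure_periodic_eq[OF m.finite_measure_axioms m(1) per F] inv[OF V(1)] m(2)
      unfolding V(2) by simp
    also have "\<dots> = emeasure leb (saturation U \<inter> U)"
      by (intro emeasure_transversal_eq per transversal_subset[OF F sub] transversal_saturation U)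
    also have "saturation U \<inter> U = U"
      using \<open>U \<subseteq> saturation U\<close> by blast
    finally show ?thesis .
  qed
  have F_sets: "F \<in> sets leb"
    using F by (simp add: transversal_def)
  have covered: "emeasure N H = 0" if "sets N = sets (borel_on H)" "\<And>U. U \<in> \<B> \<Longrightarrow> emeasure N U = 0" for N
  proof -
    have "(\<Union>U\<in>\<B>. U) \<in> null_sets N"
      using \<B> that small_sets by (intro null_sets_UN') auto
    then show ?thesis
      using \<B>(3) by (simp add: null_sets_def)
  qed
  have F0: "emeasure leb F \<noteq> 0"
  proof
    assume "emeasure leb F = 0"
    then have "emeasure leb U = 0" if "U \<in> \<B>" for U
      using key[OF \<B>(2)[OF that]] by simp
    then show False
      using covered[of leb] emeasure_subspace_lborel_space_nonzero[OF subspace] by simp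
  qed
  have F_fin: "emeasure leb F \<noteq> \<infinity>"
  proof
    assume inf: "emeasure leb F = \<infinity>"
    have "emeasure m U = 0" if "U \<in> \<B>" for U
    proof -
      note U = \<B>(2)[OF that]
      have "bounded U"
      proof (cases "U = {}")
        case False
        then obtain u where "u \<in> U"
          by blast
        then have "U \<subseteq> ball u \<delta>"
          using U by (auto simp: small_open_def dist_norm)
        then show ?thesis
          using bounded_subset bounded_ball by blast
      qed simp
      then have "emeasure leb U \<noteq> \<infinity>"
        using emeasure_subspace_lborel_bounded[OF subspace] by (simp add: less_top)
      then have "emeasure m (saturation U) = 0"
        using key[OF U] inf by (auto simp: ennreal_top_mult split: if_splits)
      moreover have "emeasure m U \<le> emeasure m (saturation U)"
      proof (rule emeasure_mono)
        obtain V where V: "open V" "U = H \<inter> V"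
          using U by (auto simp: small_open_def)
        then show "saturation U \<in> sets m"
          using periodic_saturation[OF V(1)] m(1) by (simp add: periodic_def)
        show "U \<subseteq> saturation U"
          using zero_J V(2) by (auto simp: saturation_def intro!: bexI[of _ 0])
      qed
      ultimately show ?thesis
        by simp
    qed
    then show False
      using covered[OF m(1)] m(2) by simp
  qed
  show ?thesis
  proof (rule measure_eqI_generator_eq_countable[where E = "{U. small_open U}" and \<Omega> = H and A = \<B>])
    show "Int_stable {U. small_open U}"
    proof (rule Int_stableI)
      fix U U' assume "U \<in> {U. small_open U}" "U' \<in> {U. small_open U}"
      then obtain V V' where "open V" "U = H \<inter> V" "open V'" "U' = H \<inter> V'"
        and "\<forall>x\<in>U. \<forall>y\<in>U. norm (x - y) < \<delta>"
        by (auto simp: small_open_def)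
      then show "U \<inter> U' \<in> {U. small_open U}"
        by (auto simp: small_open_def intro!: exI[of _ "V \<inter> V'"])
    qed
    fix U assume "U \<in> {U. small_open U}"
    then have U: "small_open U"
      by simp
    have "emeasure (periodisation m) U = emeasure m (saturation U)"
      by (rule emeasure_periodisation_small[OF m(1) U])
    also have "\<dots> = emeasure leb F * emeasure m (saturation U) / emeasure leb F"
      using F0 F_fin by (simp add: ennreal_mult_divide_eq mult.commute[of "emeasure leb F"])
    also have "\<dots> = emeasure (scale_measure (1 / emeasure leb F) leb) U"
      by (simp add: key[OF U] divide_ennreal_def mult.commute)
    finally show "emeasure (periodisation m) U = emeasure (scale_measure (1 / emeasure leb F) leb) U" .
  next
    fix U assume "U \<in> \<B>"
    then show "emeasure (periodisation m) U \<noteq> \<infinity>"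
      using emeasure_periodisation_small[OF m(1) \<B>(2)] m.emeasure_finite by simp
  qed (use \<B> gen in \<open>auto simp: periodisation_def small_open_def\<close>)
qed

text \<open>Weak limits can be tested against these functions on \<open>H\<close>, and they descend to the quotient
  of \<open>H\<close> by \<open>J\<close>. Nonnegativity lets one compute their integrals as nonnegative integrals.\<close>

definition periodic_test :: "('b \<Rightarrow> real) \<Rightarrow> bool" where
  "periodic_test f \<longleftrightarrow> continuous_on H f \<and> bounded (f ` H) \<and> (\<forall>x\<in>H. 0 \<le> f x) \<and>
     (\<forall>x\<in>H. \<forall>j\<in>J. f (x + j) = f x)"

lemma periodic_test_translate:
  assumes f: "periodic_test f" and h: "h \<in> H"
  shows "periodic_test (\<lambda>x. f (x + h))"
proof -
  have in_H: "x + h \<in> H" if "x \<in> H" for x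
    using that h subspace by (simp add: subspace_add)
  have "continuous_on H (\<lambda>x. f (x + h))"
    using f in_H
    by (intro continuous_on_compose2[of H f H "\<lambda>x. x + h"] continuous_intros)
      (auto simp: periodic_test_def)
  moreover have "bounded ((\<lambda>x. f (x + h)) ` H)"
    by (rule bounded_subset[of "f ` H"]) (use f in_H in \<open>auto simp: periodic_test_def\<close>)
  moreover have "f (x + j + h) = f (x + h)" if "x \<in> H" "j \<in> J" for x j
  proof -
    have swap: "x + j + h = x + h + j"
      by (simp add: add.commute add.left_commute)
    show ?thesis
      unfolding swap using f in_H[OF that(1)] that(2) by (auto simp: periodic_test_def)
  qed
  ultimately show ?thesis
    using f in_H by (simp add: periodic_test_def)
qed

lemma periodic_test_measurable:
  assumes "periodic_test f" "sets m = sets (borel_on H)"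
  shows "f \<in> borel_measurable m"
proof -
  have "f \<in> borel_measurable (borel_on H)"
    unfolding borel_on_def using assms(1)
    by (intro borel_measurable_continuous_on_restrict) (simp add: periodic_test_def)
  then show ?thesis
    using assms(2) by (simp cong: measurable_cong_sets)
qed

lemma periodic_test_bound:
  assumes "periodic_test f"
  obtains K where "\<And>x. x \<in> H \<Longrightarrow> norm (f x) \<le> K"
proof -
  obtain K where "\<forall>y\<in>f ` H. norm y \<le> K"
    using assms unfolding periodic_test_def bounded_iff by blast
  then show thesis
    by (intro that[of K]) auto
qed

text \<open>The translations under which all test integrals are invariant form a group that contains \<open>J\<close> and
  \<open>\<alpha>\<close>. By dominated convergence this group is closed.\<close>

lemma translation_invariant_if_dense:
  assumes m: "finite_measure m" "sets m = sets (borel_on H)"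
    and \<alpha>: "\<alpha> \<in> H" "\<And>f. periodic_test f \<Longrightarrow> (\<integral>x. f (x + \<alpha>) \<partial>m) = (\<integral>x. f x \<partial>m)"
    and dense: "\<And>h e. h \<in> H \<Longrightarrow> e > 0 \<Longrightarrow> \<exists>k :: int. \<exists>j\<in>J. norm (of_int k *\<^sub>R \<alpha> + j - h) < e"
    and h: "h \<in> H" and f: "periodic_test f"
  shows "(\<integral>x. f (x + h) \<partial>m) = (\<integral>x. f x \<partial>m)"
proof -
  interpret m: finite_measure m by fact
  have space_m: "space m = H"
    using sets_eq_imp_space_eq[OF m(2)] by simp
  define T where "T = {h\<in>H. \<forall>f. periodic_test f \<longrightarrow> (\<integral>x. f (x + h) \<partial>m) = (\<integral>x. f x \<partial>m)}"
  have T_add: "h + h' \<in> T" if hh: "h \<in> T" "h' \<in> T" for h h'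
  proof -
    have "(\<integral>x. f (x + (h + h')) \<partial>m) = (\<integral>x. f x \<partial>m)" if f: "periodic_test f" for f
    proof -
      have "(\<integral>x. f (x + (h + h')) \<partial>m) = (\<integral>x. f ((x + h) + h') \<partial>m)"
        by (simp add: add.assoc)
      also have "\<dots> = (\<integral>x. f (x + h') \<partial>m)"
        using hh periodic_test_translate[OF f, of h'] unfolding T_def by blast
      also have "\<dots> = (\<integral>x. f x \<partial>m)"
        using hh f by (simp add: T_def)
      finally show ?thesis .
    qed
    then show ?thesis
      using hh subspace by (simp add: T_def subspace_add)
  qed
  have T_minus: "- h \<in> T" if h: "h \<in> T" for h
  proof -
    have mh: "- h \<in> H"
      using h subspace by (simp add: T_def subspace_neg)
    have "(\<integral>x. f (x + - h) \<partial>m) = (\<integral>x. f x \<partial>m)" if f: "periodic_test f" for f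
    proof -
      have "(\<integral>x. f ((x + h) + - h) \<partial>m) = (\<integral>x. f (x + - h) \<partial>m)"
        using h periodic_test_translate[OF f mh] unfolding T_def by blast
      then show ?thesis
        by simp
    qed
    then show ?thesis
      using mh by (simp add: T_def)
  qed
  have T_J: "j \<in> T" if "j \<in> J" for j
    using that J_subset
    by (auto simp: T_def periodic_test_def space_m intro!: Bochner_Integration.integral_cong)
  have T_0: "0 \<in> T"
    using T_J zero_J by blast
  have T_nat: "of_nat k *\<^sub>R \<alpha> \<in> T" for k
  proof (induction k)
    case (Suc k)
    have "\<alpha> \<in> T"
      using \<alpha> by (simp add: T_def)
    then show ?case
      using T_add[OF _ Suc] by (simp add: algebra_simps)
  qed (simp add: T_0)
  have T_int: "of_int k *\<^sub>R \<alpha> \<in> T" for k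
    using T_nat[of "nat k"] T_minus[OF T_nat[of "nat (- k)"]]
    by (cases "k \<ge> 0") simp_all
  have "\<exists>g\<in>T. norm (g - h) < 1 / real (Suc n)" for n
    using dense[OF h, of "1 / real (Suc n)"] T_add[OF T_int T_J] by fastforce
  then obtain g where g: "\<And>n. g n \<in> T" "\<And>n. norm (g n - h) < 1 / real (Suc n)"
    by metis
  have "(\<lambda>n. g n - h) \<longlonglongrightarrow> 0"
    using g(2) by (intro Lim_null_comparison[OF _ LIMSEQ_inverse_real_of_nat])
      (auto intro!: always_eventually less_imp_le simp: inverse_eq_divide)
  then have lim: "g \<longlonglongrightarrow> h"
    by (rule LIM_zero_cancel)
  have gH: "g n \<in> H" for n
    using g(1) by (simp add: T_def)
  obtain K where K: "\<And>x. x \<in> H \<Longrightarrow> norm (f x) \<le> K"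
    using periodic_test_bound[OF f] by blast
  have "(\<lambda>n. \<integral>x. f (x + g n) \<partial>m) \<longlonglongrightarrow> (\<integral>x. f (x + h) \<partial>m)"
  proof (rule integral_dominated_convergence[where w = "\<lambda>_. K"])
    show "AE x in m. (\<lambda>n. f (x + g n)) \<longlonglongrightarrow> f (x + h)"
    proof (rule AE_I2)
      fix x assume "x \<in> space m"
      then have x: "x \<in> H"
        by (simp add: space_m)
      show "(\<lambda>n. f (x + g n)) \<longlonglongrightarrow> f (x + h)"
        using f x h gH subspace lim unfolding periodic_test_def
        by (intro continuous_on_tendsto_compose[of H f]) (auto intro!: tendsto_add always_eventually simp: subspace_add)
    qed
    show "AE x in m. norm (f (x + g n)) \<le> K" for n
      using K gH subspace by (auto intro!: AE_I2 simp: space_m subspace_add)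
  qed (use periodic_test_measurable[OF periodic_test_translate[OF f] m(2)] h gH in auto)
  moreover have "(\<integral>x. f (x + g n) \<partial>m) = (\<integral>x. f x \<partial>m)" for n
    using g(1)[of n] f by (simp add: T_def)
  ultimately show ?thesis
    by (simp add: LIMSEQ_const_iff)
qed

lemma infdist_periodic:
  assumes C: "periodic C" and j: "j \<in> J" and ne: "C \<noteq> {}"
  shows "infdist (x + j) C = infdist x C"
proof -
  have le: "infdist (x + j) C \<le> infdist x C" if j: "j \<in> J" for x j
  proof -
    have "infdist (x + j) C \<le> dist x a" if "a \<in> C" for a
      using C that j infdist_le[of "a + j" C "x + j"] by (simp add: periodic_def dist_norm)
    then show ?thesis
      using ne by (simp add: infdist_def[of x] cINF_greatest)
  qed
  show ?thesis
    using le[OF j, of x] le[OF minus_J[OF j], of "x + j"] by simp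
qed

text \<open>The indicator of a closed periodic set is the pointwise limit of the test functions
  \<open>max 0 (1 - n dist(x, C))\<close>, which are periodic because \<open>C\<close> is.\<close>

lemma emeasure_closed_translate:
  assumes m: "finite_measure m" "sets m = sets (borel_on H)"
    and inv: "\<And>f h. periodic_test f \<Longrightarrow> h \<in> H \<Longrightarrow> (\<integral>x. f (x + h) \<partial>m) = (\<integral>x. f x \<partial>m)"
    and C: "periodic C" "closed C" and h: "h \<in> H"
  shows "emeasure m {x\<in>H. x + h \<in> C} = emeasure m C"
proof (cases "C = {}")
  case ne: False
  interpret m: finite_measure m by fact
  have space_m: "space m = H"
    using sets_eq_imp_space_eq[OF m(2)] by simp
  have C_sets: "C \<in> sets (borel_on H)"
    using C by (simp add: periodic_def)
  define f where "f = (\<lambda>n::nat. \<lambda>x. max 0 (1 - real n * infdist x C))"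
  have f: "periodic_test (f n)" for n
    unfolding periodic_test_def
  proof (intro conjI)
    show "continuous_on H (f n)"
      unfolding f_def by (intro continuous_intros)
    show "bounded (f n ` H)"
      by (intro boundedI[of _ 1]) (auto simp: f_def infdist_nonneg)
  qed (simp_all add: f_def infdist_periodic[OF C(1) _ ne])
  have f_lim: "(\<lambda>n. f n x) \<longlonglongrightarrow> indicator C x" for x
  proof (cases "x \<in> C")
    case False
    then have "infdist x C > 0"
      using C(2) ne in_closed_iff_infdist_zero[of C x] infdist_nonneg[of x C] by linarith
    then obtain N where "1 < real N * infdist x C"
      using reals_Archimedean3 by blast
    then have "f n x = 0" if "n \<ge> N" for n
      using that mult_right_mono[of "real N" "real n" "infdist x C"] infdist_nonneg[of x C]
      by (simp add: f_def)
    then show ?thesis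
      using False by (intro tendsto_eventually) (auto simp: eventually_sequentially)
  qed (simp add: f_def)
  have lim: "(\<lambda>n. \<integral>x. f n (x + t) \<partial>m) \<longlonglongrightarrow> measure m {x\<in>H. x + t \<in> C}" if t: "t \<in> H" for t
  proof -
    have Ct: "{x\<in>H. x + t \<in> C} \<in> sets m"
      unfolding m(2) using C_sets t by auto
    have "(\<lambda>n. \<integral>x. f n (x + t) \<partial>m) \<longlonglongrightarrow> (\<integral>x. indicator {x\<in>H. x + t \<in> C} x \<partial>m)"
    proof (rule integral_dominated_convergence[where w = "\<lambda>_. 1"])
      show "AE x in m. (\<lambda>n. f n (x + t)) \<longlonglongrightarrow> indicator {x\<in>H. x + t \<in> C} x"
        using f_lim[of "_ + t"] by (intro AE_I2) (simp add: space_m indicator_def)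
      show "AE x in m. norm (f n (x + t)) \<le> 1" for n
        by (auto intro!: AE_I2 simp: f_def infdist_nonneg)
    qed (use periodic_test_measurable[OF periodic_test_translate[OF f t] m(2)] Ct in auto)
    then show ?thesis
      using Ct by simp
  qed
  have "{x\<in>H. x + 0 \<in> C} = C"
    using C_sets sets_subset_H by auto
  then have "(\<lambda>n. \<integral>x. f n x \<partial>m) \<longlonglongrightarrow> measure m C"
    using lim[of 0] subspace by (simp add: subspace_0)
  then have "measure m {x\<in>H. x + h \<in> C} = measure m C"
    using LIMSEQ_unique lim[OF h] inv[OF f h] by simp
  then show ?thesis
    by (simp add: m.emeasure_eq_measure)
qed simp

lemma emeasure_saturation_translate:
  assumes m: "finite_measure m" "sets m = sets (borel_on H)"
    and inv: "\<And>f h. periodic_test f \<Longrightarrow> h \<in> H \<Longrightarrow> (\<integral>x. f (x + h) \<partial>m) = (\<integral>x. f x \<partial>m)"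
    and V: "open V" and h: "h \<in> H"
  shows "emeasure m {x\<in>H. x + h \<in> saturation (H \<inter> V)} = emeasure m (saturation (H \<inter> V))"
proof -
  interpret m: finite_measure m by fact
  let ?W = "saturation (H \<inter> V)"
  have space_m: "space m = H"
    using sets_eq_imp_space_eq[OF m(2)] by simp
  have W: "periodic ?W"
    by (rule periodic_saturation[OF V])
  have W_sets: "?W \<in> sets (borel_on H)"
    using W by (simp add: periodic_def)
  have add_H: "x + y \<in> H" if "x \<in> H" "y \<in> H" for x y
    using that subspace by (simp add: subspace_add)
  have "periodic (H - ?W)"
    unfolding periodic_def
  proof (intro conjI ballI)
    show "H - ?W \<in> sets (borel_on H)"
      using sets.compl_sets[OF W_sets] by simp
    fix x j assume "x \<in> H - ?W" "j \<in> J"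
    then show "x + j \<in> H - ?W"
      using periodic_minus[OF W, of "x + j" j] add_H[of x j] J_subset by auto
  qed
  moreover have "closed (H - ?W)"
  proof -
    have "open (\<Union>j\<in>J. (+) j ` V)"
      using V by (auto intro: open_translation)
    moreover have "H - ?W = H - (\<Union>j\<in>J. (+) j ` V)"
      unfolding saturation_open[OF V] by blast
    ultimately show ?thesis
      using closed_subspace[OF subspace] by (metis closed_Diff)
  qed
  ultimately have eq: "emeasure m {x\<in>H. x + h \<in> H - ?W} = emeasure m (H - ?W)"
    using emeasure_closed_translate[OF m inv] h by blast
  have "emeasure m {x\<in>H. x + h \<in> ?W} = emeasure m (space m - {x\<in>H. x + h \<in> H - ?W})"
    using add_H h by (intro arg_cong[of _ _ "emeasure m"]) (auto simp: space_m)
  also have "\<dots> = emeasure m (space m) - emeasure m {x\<in>H. x + h \<in> H - ?W}"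
    using sets_translate[OF h sets.compl_sets[OF W_sets]] m(2)
    by (intro emeasure_compl) (simp_all add: m.emeasure_finite)
  also have "\<dots> = emeasure m (space m) - emeasure m (space m - ?W)"
    using eq by (simp add: space_m)
  also have "\<dots> = emeasure m (space m - (space m - ?W))"
    using sets.compl_sets[OF W_sets] m(2)
    by (intro emeasure_compl[symmetric]) (simp_all add: m.emeasure_finite space_m)
  also have "space m - (space m - ?W) = ?W"
    using sets_subset_H[OF W_sets] by (auto simp: space_m)
  finally show ?thesis .
qed

end

section \<open>Lengths and abelianisations of random words\<close>

lemma abelianisation_append: "abelianisation (u @ v) = abelianisation u + abelianisation v"
  by (simp add: abelianisation_def vec_eq_iff)

lemma abelianisation_Cons: "abelianisation (a # u) = axis a 1 + abelianisation u"
  by (simp add: abelianisation_def vec_eq_iff axis_def)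

lemma abelianisation_Nil: "abelianisation [] = 0"
  by (simp add: abelianisation_def vec_eq_iff)

lemma length_eq_sum_abelianisation:
  fixes u :: "'a::finite list"
  shows "real (length u) = (\<Sum>i\<in>UNIV. abelianisation u $ i)"
  using sum_count_set[of u UNIV] by (simp add: abelianisation_def flip: of_nat_sum)

lemma abelianisation_letter_image:
  fixes P :: "'a::finite \<Rightarrow> 'a list pmf"
  assumes "compatible P" "u \<in> set_pmf (P a)"
  shows "abelianisation u = subst_matrix P *v axis a 1"
proof -
  have "(SOME v. v \<in> set_pmf (P a)) \<in> set_pmf (P a)"
    using assms(2) by (rule someI)
  then have "abelianisation u = abelianisation (SOME v. v \<in> set_pmf (P a))"
    using assms unfolding compatible_def by blast
  then show ?thesis
    by (simp add: matrix_vector_mult_basis column_def subst_matrix_def abelianisation_def)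
qed

text \<open>Compatibility makes abelianisation deterministic: it evolves under the substitution matrix.\<close>

lemma abelianisation_subst_word:
  fixes P :: "'a::finite \<Rightarrow> 'a list pmf"
  assumes "compatible P" "w \<in> set_pmf (subst_word P u)"
  shows "abelianisation w = subst_matrix P *v abelianisation u"
  using assms(2)
proof (induction u arbitrary: w)
  case Nil
  then show ?case
    by (simp add: abelianisation_Nil)
next
  case (Cons a u)
  then obtain x y where "x \<in> set_pmf (P a)" "y \<in> set_pmf (subst_word P u)" "w = x @ y"
    by (auto simp: set_bind_pmf)
  then show ?case
    using Cons.IH abelianisation_letter_image[OF assms(1)]
    by (simp add: abelianisation_append abelianisation_Cons matrix_vector_right_distrib)
qed

lemma abelianisation_subst_chain:
  fixes P :: "'a::finite \<Rightarrow> 'a list pmf"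
  assumes "compatible P" "w \<in> set_pmf (subst_chain P n v)"
  shows "abelianisation w = ((\<lambda>x. subst_matrix P *v x) ^^ n) (abelianisation v)"
  using assms(2)
proof (induction n arbitrary: w)
  case (Suc n)
  then obtain u where "u \<in> set_pmf (subst_chain P n v)" "w \<in> set_pmf (subst_word P u)"
    by (auto simp: set_bind_pmf)
  then show ?case
    using Suc.IH abelianisation_subst_word[OF assms(1)] by simp
qed simp

lemma length_subst_chain:
  fixes P :: "'a::finite \<Rightarrow> 'a list pmf"
  assumes "compatible P" "w \<in> set_pmf (subst_chain P n v)"
  shows "length w = subst_length P n v"
proof -
  have "(SOME w. w \<in> set_pmf (subst_chain P n v)) \<in> set_pmf (subst_chain P n v)"
    using assms(2) by (rule someI)
  then have "real (length w) = real (subst_length P n v)"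
    unfolding subst_length_def length_eq_sum_abelianisation
    using abelianisation_subst_chain[OF assms(1)] assms(2) by metis
  then show ?thesis
    by simp
qed

text \<open>Each of two distinct Perron--Frobenius eigenvalues would have to be smaller than the other.\<close>

lemma pf_eigenvalue_unique:
  fixes A :: "real ^ 'n ^ 'n"
  assumes l: "pf_eigenvalue A l" and k: "pf_eigenvalue A k"
  shows "l = k"
proof -
  have complexify: "is_eigenvalue (\<chi> i j. complex_of_real (A $ i $ j)) (complex_of_real c)"
    if ev: "is_eigenvalue A c" for c
  proof -
    obtain x where x: "x \<noteq> 0" "A *v x = c *s x"
      using ev by (auto simp: is_eigenvalue_def)
    have "(\<chi> i j. complex_of_real (A $ i $ j)) *v (\<chi> i. complex_of_real (x $ i)) =
        complex_of_real c *s (\<chi> i. complex_of_real (x $ i))"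
      using x(2) by (simp add: vec_eq_iff matrix_vector_mult_def flip: of_real_mult of_real_sum)
    moreover have "(\<chi> i. complex_of_real (x $ i)) \<noteq> 0"
      using x(1) by (simp add: vec_eq_iff)
    ultimately show ?thesis
      unfolding is_eigenvalue_def by blast
  qed
  show ?thesis
  proof (rule ccontr)
    assume "l \<noteq> k"
    then have "cmod (complex_of_real l) < k" "cmod (complex_of_real k) < l"
      using l k complexify unfolding pf_eigenvalue_def by (metis of_real_eq_iff)+
    then show False
      by simp
  qed
qed

text \<open>Pairing with the left eigenvector \<open>L\<close> multiplies by \<open>l\<close> in each step, and the pairing of \<open>L\<close> with
  the abelianisation of a word is at most a constant times its length.\<close>

lemma subst_length_exponential_lower_bound:
  fixes P :: "'a::finite \<Rightarrow> 'a list pmf" and L :: "real ^ 'a"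
  assumes P: "compatible P" and L: "L v* subst_matrix P = l *s L" "\<And>i. 0 < L $ i" and v: "v \<noteq> []"
  obtains c where "c > 0" "\<And>n. l ^ n * c \<le> real (subst_length P n v)"
proof -
  define s where "s = (\<Sum>i\<in>UNIV. L $ i)"
  have L_le: "L $ i \<le> s" for i
    unfolding s_def using L(2) by (intro member_le_sum) (auto intro: less_imp_le)
  have s: "s > 0"
    unfolding s_def using L(2) by (intro sum_pos) auto
  have pow: "L \<bullet> ((\<lambda>x. subst_matrix P *v x) ^^ n) x = l ^ n * (L \<bullet> x)" for n x
  proof (induction n)
    case (Suc n)
    have "L \<bullet> (subst_matrix P *v y) = l * (L \<bullet> y)" for y
      unfolding dot_lmul_matrix[symmetric] L(1) scalar_mult_eq_scaleR by simp
    then show ?case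
      using Suc by simp
  qed simp
  have pos: "L \<bullet> abelianisation v > 0"
  proof -
    obtain a u where "v = a # u"
      using v by (cases v) auto
    moreover have "L \<bullet> abelianisation u \<ge> 0"
      unfolding inner_vec_def abelianisation_def using L(2) by (intro sum_nonneg) (simp add: less_imp_le)
    ultimately show ?thesis
      using L(2)[of a] by (simp add: abelianisation_Cons inner_add_right inner_axis)
  qed
  show thesis
  proof (rule that[of "(L \<bullet> abelianisation v) / s"])
    fix n
    obtain w where w: "w \<in> set_pmf (subst_chain P n v)"
      using set_pmf_not_empty[of "subst_chain P n v"] by blast
    have "l ^ n * (L \<bullet> abelianisation v) = L \<bullet> abelianisation w"
      unfolding abelianisation_subst_chain[OF P w] pow ..
    also have "\<dots> \<le> (\<Sum>i\<in>UNIV. s * abelianisation w $ i)"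
      unfolding inner_vec_def using L_le by (intro sum_mono) (simp add: abelianisation_def mult_right_mono)
    also have "\<dots> = s * real (subst_length P n v)"
      using length_eq_sum_abelianisation[of w] length_subst_chain[OF P w] by (simp flip: sum_distrib_left)
    finally show "l ^ n * ((L \<bullet> abelianisation v) / s) \<le> real (subst_length P n v)"
      using s by (simp add: field_simps)
  qed (use pos s in simp)
qed

section \<open>Rauzy measures and averages along a rotation\<close>

text \<open>Modulo the lattice, the projection of an integer point depends on its coordinate sum only.\<close>

lemma integer_projection_mod_lattice:
  fixes L R :: "real ^ 'a" and n :: "'a \<Rightarrow> int"
  shows "proj_along L R (\<chi> i. of_int (n i)) - of_int (\<Sum>i\<in>UNIV. n i) *\<^sub>R proj_along L R (axis a 1)
    \<in> rauzy_lattice L R a"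
  unfolding rauzy_lattice_iff
proof (intro exI conjI)
  let ?s = "\<Sum>i\<in>UNIV. n i"
  let ?m = "\<lambda>i. n i - (if i = a then ?s else 0)"
  show "(\<Sum>i\<in>UNIV. ?m i) = 0"
    by (simp add: sum_subtractf)
  have "(\<chi> i. of_int (?m i)) = (\<chi> i. of_int (n i)) - of_int ?s *\<^sub>R (axis a 1 :: real ^ 'a)"
    by (simp add: vec_eq_iff axis_def)
  then show "proj_along L R (\<chi> i. of_int (n i)) - of_int ?s *\<^sub>R proj_along L R (axis a 1) =
      proj_along L R (\<chi> i. of_int (?m i))"
    by (simp only: linear_diff[OF linear_proj_along] linear_cmul[OF linear_proj_along])
qed

lemma prefix_projection_mod_lattice:
  fixes L R :: "real ^ 'a::finite"
  assumes "m \<le> length w"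
  shows "proj_along L R (abelianisation (take m w)) - of_nat m *\<^sub>R proj_along L R (axis a 1)
    \<in> rauzy_lattice L R a"
proof -
  have "(\<Sum>i\<in>UNIV. int (count_list (take m w) i)) = int m"
    using assms sum_count_set[of "take m w" UNIV] by (simp flip: of_nat_sum)
  then show ?thesis
    using integer_projection_mod_lattice[of L R "\<lambda>i. int (count_list (take m w) i)" a]
    by (simp add: abelianisation_def)
qed

lemma nn_integral_word_measure:
  fixes L R :: "real ^ 'a::finite" and f :: "real ^ 'a \<Rightarrow> ennreal"
  assumes LR: "L \<bullet> R = 1" and f: "f \<in> borel_measurable (borel_on (hyperplane L))"
  shows "(\<integral>\<^sup>+ x. f x \<partial>word_measure L R a w) =
    (\<Sum>m | m < length w \<and> w ! m = a. f (proj_along L R (abelianisation (take m w))))"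
  unfolding word_measure_def using f
  by (subst nn_integral_distr) (auto simp: nn_integral_count_space_finite proj_along_in_hyperplane[OF LR])

lemma sets_word_measure: "sets (word_measure L R a w) = sets (borel_on (hyperplane L))"
  by (simp add: word_measure_def)

lemma expected_measure_eq_mixture: "expected_measure p M K = mixture (measure_pmf p) M K"
  by (simp add: expected_measure_def mixture_def)

text \<open>For a periodic function the value at a prefix depends on the length of the prefix only. Summing over
  the letters lets every position of the word contribute once, so the result is the same for all words of the
  same length and the expectation disappears.\<close>

lemma sum_nn_integral_expected_measure:
  fixes L R :: "real ^ 'a::finite" and f :: "real ^ 'a \<Rightarrow> real"
  assumes LR: "L \<bullet> R = 1" and f: "f \<in> borel_measurable (borel_on (hyperplane L))"
    and nonneg: "\<And>x. x \<in> hyperplane L \<Longrightarrow> 0 \<le> f x"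
    and per: "\<And>x j. x \<in> hyperplane L \<Longrightarrow> j \<in> rauzy_lattice L R a\<^sub>1 \<Longrightarrow> f (x + j) = f x"
    and len: "\<And>w. w \<in> set_pmf p \<Longrightarrow> length w = N"
  shows "(\<Sum>a\<in>UNIV. \<integral>\<^sup>+ x. ennreal (f x) \<partial>expected_measure p (borel_on (hyperplane L)) (word_measure L R a)) =
    ennreal (\<Sum>m<N. f (of_nat m *\<^sub>R proj_along L R (axis a\<^sub>1 1)))"
proof -
  let ?g = "\<lambda>m. f (of_nat m *\<^sub>R proj_along L R (axis a\<^sub>1 1))"
  have multiple: "of_nat m *\<^sub>R proj_along L R (axis a\<^sub>1 1) \<in> hyperplane L" for m :: nat
    using proj_along_in_hyperplane[OF LR, of "of_nat m *\<^sub>R axis a\<^sub>1 1"]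
    by (simp add: linear_cmul[OF linear_proj_along])
  have prefix: "f (proj_along L R (abelianisation (take m w))) = ?g m" if "m < length w" for m w
    using per[OF multiple[of m] prefix_projection_mod_lattice[of m w L R a\<^sub>1]] that by simp
  have word: "(\<Sum>a\<in>UNIV. \<integral>\<^sup>+ x. ennreal (f x) \<partial>word_measure L R a w) = ennreal (\<Sum>m<length w. ?g m)" for w
  proof -
    have "(\<Sum>a\<in>UNIV. \<integral>\<^sup>+ x. ennreal (f x) \<partial>word_measure L R a w) =
        (\<Sum>a\<in>UNIV. \<Sum>m | m \<in> {..<length w} \<and> w ! m = a. ennreal (?g m))"
      using f by (intro sum.cong refl) (auto simp: nn_integral_word_measure[OF LR] prefix intro!: sum.cong)
    also have "\<dots> = (\<Sum>m<length w. ennreal (?g m))"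
      by (rule sum.group) auto
    also have "\<dots> = ennreal (\<Sum>m<length w. ?g m)"
      using nonneg multiple by (intro sum_ennreal) auto
    finally show ?thesis .
  qed
  have "(\<Sum>a\<in>UNIV. \<integral>\<^sup>+ x. ennreal (f x) \<partial>expected_measure p (borel_on (hyperplane L)) (word_measure L R a)) =
      (\<Sum>a\<in>UNIV. \<integral>\<^sup>+ w. (\<integral>\<^sup>+ x. ennreal (f x) \<partial>word_measure L R a w) \<partial>measure_pmf p)"
    using f by (intro sum.cong refl)
      (simp add: expected_measure_eq_mixture nn_integral_mixture sets_word_measure)
  also have "\<dots> = (\<integral>\<^sup>+ w. (\<Sum>a\<in>UNIV. \<integral>\<^sup>+ x. ennreal (f x) \<partial>word_measure L R a w) \<partial>measure_pmf p)"
    by (rule nn_integral_sum[symmetric]) simp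
  also have "\<dots> = (\<integral>\<^sup>+ w. ennreal (\<Sum>m<N. ?g m) \<partial>measure_pmf p)"
    using len by (intro nn_integral_cong_AE) (auto simp: AE_measure_pmf_iff word)
  finally show ?thesis
    by simp
qed

lemma integral_total_mixture:
  fixes \<mu> :: "'a::finite \<Rightarrow> 'b measure" and f :: "'b \<Rightarrow> real"
  assumes \<mu>: "\<And>a. sets (\<mu> a) = sets M" "\<And>a. finite_measure (\<mu> a)"
    and f: "f \<in> borel_measurable M" "\<And>x. x \<in> space M \<Longrightarrow> 0 \<le> f x" "\<And>x. x \<in> space M \<Longrightarrow> f x \<le> K"
  shows "(\<integral>x. f x \<partial>mixture (count_space UNIV) M \<mu>) = (\<Sum>a\<in>UNIV. \<integral>x. f x \<partial>\<mu> a)"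
proof -
  have space: "space (\<mu> a) = space M" for a
    using sets_eq_imp_space_eq[OF \<mu>(1)] .
  have meas: "f \<in> borel_measurable (\<mu> a)" for a
    using f(1) \<mu>(1)[of a] by (simp cong: measurable_cong_sets)
  have int: "integrable (\<mu> a) f" for a
    using f meas by (intro finite_measure.integrable_const_bound[OF \<mu>(2), where B = K]) (auto simp: space)
  have "(\<integral>\<^sup>+ x. ennreal (f x) \<partial>mixture (count_space UNIV) M \<mu>) = (\<Sum>a\<in>UNIV. \<integral>\<^sup>+ x. ennreal (f x) \<partial>\<mu> a)"
    using f(1) \<mu>(1) by (simp add: nn_integral_mixture nn_integral_count_space_finite)
  also have "\<dots> = (\<Sum>a\<in>UNIV. ennreal (\<integral>x. f x \<partial>\<mu> a))"
    using int f(2) by (intro sum.cong refl nn_integral_eq_integral) (auto simp: space)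
  also have "\<dots> = ennreal (\<Sum>a\<in>UNIV. \<integral>x. f x \<partial>\<mu> a)"
    using f(2) by (intro sum_ennreal integral_nonneg_AE) (auto simp: space)
  finally have "(\<integral>\<^sup>+ x. ennreal (f x) \<partial>mixture (count_space UNIV) M \<mu>) = ennreal (\<Sum>a\<in>UNIV. \<integral>x. f x \<partial>\<mu> a)" .
  moreover have "0 \<le> (\<Sum>a\<in>UNIV. \<integral>x. f x \<partial>\<mu> a)"
    using f(2) by (intro sum_nonneg integral_nonneg_AE) (auto simp: space)
  ultimately show ?thesis
    using f by (subst integral_eq_nn_integral) (auto cong: measurable_cong_sets)
qed

lemma rauzy_measure_orbit_average:
  fixes P :: "'a::finite \<Rightarrow> 'a list pmf" and L R :: "real ^ 'a" and f :: "real ^ 'a \<Rightarrow> real"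
  assumes P: "compatible P" and LR: "L \<bullet> R = 1"
    and \<mu>: "\<And>a. is_rauzy_measure P L R v a (\<mu> a)"
    and cont: "continuous_on (hyperplane L) f" and bdd: "bounded (f ` hyperplane L)"
    and nonneg: "\<And>x. x \<in> hyperplane L \<Longrightarrow> 0 \<le> f x"
    and per: "\<And>x j. x \<in> hyperplane L \<Longrightarrow> j \<in> rauzy_lattice L R a\<^sub>1 \<Longrightarrow> f (x + j) = f x"
    and pos: "\<And>n. subst_length P n v > 0"
  shows "(\<lambda>n. (\<Sum>m<subst_length P n v. f (of_nat m *\<^sub>R proj_along L R (axis a\<^sub>1 1))) / real (subst_length P n v))
    \<longlonglongrightarrow> (\<Sum>a\<in>UNIV. \<integral>x. f x \<partial>\<mu> a)"
proof -
  let ?H = "borel_on (hyperplane L)"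
  let ?N = "\<lambda>n. subst_length P n v"
  let ?E = "\<lambda>n a. expected_measure (subst_chain P n v) ?H (word_measure L R a)"
  let ?K = "\<lambda>n a. scale_measure (1 / of_nat (?N n)) (?E n a)"
  let ?S = "\<lambda>n. \<Sum>m<?N n. f (of_nat m *\<^sub>R proj_along L R (axis a\<^sub>1 1))"
  have f: "f \<in> borel_measurable ?H"
    unfolding borel_on_def by (rule borel_measurable_continuous_on_restrict[OF cont])
  have sets_E: "sets (?E n a) = sets ?H" for n a
    by (simp add: expected_measure_eq_mixture)
  have "(\<Sum>a\<in>UNIV. \<integral>x. f x \<partial>?K n a) = ?S n / real (?N n)" for n
  proof -
    have S0: "0 \<le> ?S n"
      using nonneg proj_along_in_hyperplane[OF LR]
      by (intro sum_nonneg nonneg) (simp flip: linear_cmul[OF linear_proj_along])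
    have "(\<integral>\<^sup>+ x. ennreal (f x) \<partial>?K n a) = 1 / of_nat (?N n) * (\<integral>\<^sup>+ x. ennreal (f x) \<partial>?E n a)" for a
      using f sets_E by (intro nn_integral_scale_measure) (simp cong: measurable_cong_sets)
    then have "(\<Sum>a\<in>UNIV. \<integral>\<^sup>+ x. ennreal (f x) \<partial>?K n a) =
        1 / of_nat (?N n) * (\<Sum>a\<in>UNIV. \<integral>\<^sup>+ x. ennreal (f x) \<partial>?E n a)"
      by (simp add: sum_distrib_left)
    also have "\<dots> = 1 / of_nat (?N n) * ennreal (?S n)"
      using sum_nn_integral_expected_measure[OF LR f nonneg per length_subst_chain[OF P]] by simp
    also have "\<dots> = ennreal (1 / real (?N n)) * ennreal (?S n)"
      using pos[of n] by (simp add: divide_ennreal[symmetric] ennreal_of_nat_eq_real_of_nat)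
    also have "\<dots> = ennreal (?S n / real (?N n))"
      using S0 by (simp flip: ennreal_mult)
    finally have total: "(\<Sum>a\<in>UNIV. \<integral>\<^sup>+ x. ennreal (f x) \<partial>?K n a) = ennreal (?S n / real (?N n))" .
    then have fin: "(\<integral>\<^sup>+ x. ennreal (f x) \<partial>?K n a) < top" for a
      using ennreal_less_top[of "?S n / real (?N n)"] unfolding total[symmetric] by simp
    have "(\<integral>x. f x \<partial>?K n a) = enn2real (\<integral>\<^sup>+ x. ennreal (f x) \<partial>?K n a)" for a
      using f sets_E nonneg sets_eq_imp_space_eq[OF sets_E, of n a]
      by (intro integral_eq_nn_integral AE_I2)
        (auto simp: space_scale_measure cong: measurable_cong_sets)
    then have "(\<Sum>a\<in>UNIV. \<integral>x. f x \<partial>?K n a) = enn2real (\<Sum>a\<in>UNIV. \<integral>\<^sup>+ x. ennreal (f x) \<partial>?K n a)"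
      using fin by (simp add: enn2real_sum)
    also have "\<dots> = ?S n / real (?N n)"
      unfolding total using S0 by simp
    finally show ?thesis .
  qed
  moreover have "(\<lambda>n. \<Sum>a\<in>UNIV. \<integral>x. f x \<partial>?K n a) \<longlonglongrightarrow> (\<Sum>a\<in>UNIV. \<integral>x. f x \<partial>\<mu> a)"
    using \<mu> cont bdd unfolding is_rauzy_measure_def weak_limit_on_def by (intro tendsto_sum) blast
  ultimately show ?thesis
    by simp
qed

text \<open>The two sums differ by \<open>g (N n) - g 0\<close> only.\<close>

lemma orbit_average_shift:
  fixes g :: "nat \<Rightarrow> real" and N :: "nat \<Rightarrow> nat"
  assumes bdd: "\<And>m. \<bar>g m\<bar> \<le> K" and N: "filterlim (\<lambda>n. real (N n)) at_top sequentially"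
    and x: "(\<lambda>n. (\<Sum>m<N n. g (Suc m)) / real (N n)) \<longlonglongrightarrow> x"
    and y: "(\<lambda>n. (\<Sum>m<N n. g m) / real (N n)) \<longlonglongrightarrow> y"
  shows "x = y"
proof -
  have "(\<lambda>n. (\<Sum>m<N n. g (Suc m)) / real (N n) - (\<Sum>m<N n. g m) / real (N n)) \<longlonglongrightarrow> 0"
  proof (rule Lim_null_comparison)
    show "(\<lambda>n. 2 * K / real (N n)) \<longlonglongrightarrow> 0"
      by (rule tendsto_divide_0[OF tendsto_const filterlim_at_top_imp_at_infinity[OF N]])
    have "norm ((\<Sum>m<N n. g (Suc m)) / real (N n) - (\<Sum>m<N n. g m) / real (N n)) \<le> 2 * K / real (N n)" for n
    proof -
      have "(\<Sum>m<N n. g (Suc m)) - (\<Sum>m<N n. g m) = g (N n) - g 0"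
        using sum_lessThan_telescope[of g "N n"] by (simp add: sum_subtractf)
      moreover have "\<bar>g (N n) - g 0\<bar> \<le> 2 * K"
        using bdd[of "N n"] bdd[of 0] by linarith
      ultimately show ?thesis
        by (simp add: divide_right_mono flip: diff_divide_distrib)
    qed
    then show "\<forall>\<^sub>F n in sequentially. norm ((\<Sum>m<N n. g (Suc m)) / real (N n) -
        (\<Sum>m<N n. g m) / real (N n)) \<le> 2 * K / real (N n)"
      by (intro always_eventually allI)
  qed
  then have "x - y = 0"
    by (rule LIMSEQ_unique[OF tendsto_diff[OF x y]])
  then show ?thesis
    by simp
qed

lemma subspace_hyperplane: "subspace (hyperplane L)"
  by (simp add: subspace_def hyperplane_def inner_add_right)

section \<open>Periodised Rauzy measures\<close>

theorem corollary5p17: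
  fixes P :: "'a::finite \<Rightarrow> 'a list pmf"
    and L R :: "real ^ 'a"
    and \<mu> :: "'a \<Rightarrow> (real ^ 'a) measure"
    and v :: "'a list"
    and a\<^sub>1 :: 'a
    and F B :: "(real ^ 'a) set"
    and D :: ennreal
  defines "H \<equiv> hyperplane L"
    and "J \<equiv> rauzy_lattice L R a\<^sub>1"
  assumes "random_substitution P"
    and "irreducible_pisot P"
    and "pf_eigenvectors (subst_matrix P) L R"
    and "v \<noteq> []"
    and "\<And>a. is_rauzy_measure P L R v a (\<mu> a)"
    and "fundamental_domain H J F"
    and "D = 1 / emeasure (subspace_lborel H) F"
    and "B \<in> sets (borel_on H)"
  shows "(\<Sum>\<^sub>\<infinity>j\<in>J. \<Sum>a\<in>UNIV. emeasure (distr (\<mu> a) (borel_on H) (\<lambda>x. x + j)) B)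
       = D * emeasure (subspace_lborel H) B"
proof -
  note pisot = \<open>irreducible_pisot P\<close> and eigenvectors = \<open>pf_eigenvectors (subst_matrix P) L R\<close>
    and rauzy = \<open>\<And>a. is_rauzy_measure P L R v a (\<mu> a)\<close>
  have P: "compatible P" and irr: "irreducible (charpoly (subst_matrix P :: int ^ 'a ^ 'a))"
    using pisot by (auto simp: irreducible_pisot_def)
  obtain l where l: "pf_eigenvalue (subst_matrix P) l" "L v* subst_matrix P = l *s L"
      "subst_matrix P *v R = l *s R"
    and L_pos: "\<And>i. 0 < L $ i" and R_pos: "\<And>i. 0 < R $ i"
    and R_norm: "(\<Sum>i\<in>UNIV. \<bar>R $ i\<bar>) = 1" and LR: "L \<bullet> R = 1"
    using eigenvectors unfolding pf_eigenvectors_def by blast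
  have R1: "(\<Sum>i\<in>UNIV. R $ i) = 1"
    using R_norm R_pos by (simp add: abs_of_pos)
  have "R \<noteq> 0"
    using LR by auto
  have "l > 1"
    using pisot pf_eigenvalue_unique[OF l(1)]
    by (auto simp: irreducible_pisot_def primitive_substitution_def)
  let ?\<alpha> = "proj_along L R (axis a\<^sub>1 1)"
  have \<alpha>: "?\<alpha> \<in> H"
    unfolding H_def by (rule proj_along_in_hyperplane[OF LR])
  obtain \<delta> where \<delta>: "\<delta> > 0" "\<And>x. x \<in> J \<Longrightarrow> x \<noteq> 0 \<Longrightarrow> \<delta> \<le> norm x"
    unfolding J_def by (rule rauzy_lattice_discrete[OF LR R1, of a\<^sub>1]) blast
  interpret subspace_lattice H J \<delta>
    unfolding H_def J_def
    using \<delta> by unfold_locales (auto simp: subspace_hyperplane countable_rauzy_lattice zero_in_rauzy_lattice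
        J_def intro: rauzy_lattice_diff rauzy_lattice_subset[OF LR, THEN subsetD])
  have \<mu>_sets: "sets (\<mu> a) = sets (borel_on H)" and \<mu>_fin: "finite_measure (\<mu> a)" for a
    using rauzy[of a] by (auto simp: is_rauzy_measure_def weak_limit_on_def H_def)
  (* The sum of the Rauzy measures. *)
  define m where "m = mixture (count_space UNIV) (borel_on H) \<mu>"
  have m_sets: "sets m = sets (borel_on H)"
    by (simp add: m_def)
  have space_m: "space m = H"
    by (simp add: m_def)
  have emeasure_m: "emeasure m A = (\<Sum>a\<in>UNIV. emeasure (\<mu> a) A)" if "A \<in> sets (borel_on H)" for A
    using that by (simp add: m_def emeasure_mixture \<mu>_sets nn_integral_count_space_finite)
  have H_sets: "H \<in> sets (borel_on H)"
    using sets.top[of "borel_on H"] by simp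
  have m_fin: "finite_measure m"
    using finite_measure.emeasure_finite[OF \<mu>_fin]
    by (intro finite_measureI) (simp add: space_m emeasure_m[OF H_sets])
  let ?N = "\<lambda>n. subst_length P n v"
  obtain c where c: "c > 0" "\<And>n. l ^ n * c \<le> real (?N n)"
    using subst_length_exponential_lower_bound[OF P l(2) L_pos \<open>v \<noteq> []\<close>] by blast
  have N_lim: "filterlim (\<lambda>n. real (?N n)) at_top sequentially"
  proof (rule filterlim_at_top_mono)
    show "filterlim (\<lambda>n. l ^ n * c) at_top sequentially"
      using c(1) \<open>l > 1\<close>
      by (intro filterlim_at_top_mult_tendsto_pos[OF tendsto_const]
          filterlim_at_infinity_imp_filterlim_at_top[OF filterlim_realpow_sequentially_gt1]) auto
  qed (use c(2) in \<open>simp add: always_eventually\<close>)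
  have N_pos: "?N n > 0" for n
  proof -
    have "0 < l ^ n * c"
      using c(1) \<open>l > 1\<close> by simp
    then show ?thesis
      using c(2)[of n] by simp
  qed
  have average: "(\<lambda>n. (\<Sum>i<?N n. f (of_nat i *\<^sub>R ?\<alpha>)) / real (?N n)) \<longlonglongrightarrow> (\<integral>x. f x \<partial>m)"
    if f: "periodic_test f" for f
  proof -
    obtain K where K: "\<And>x. x \<in> H \<Longrightarrow> norm (f x) \<le> K"
      using periodic_test_bound[OF f] by blast
    have "(\<integral>x. f x \<partial>m) = (\<Sum>a\<in>UNIV. \<integral>x. f x \<partial>\<mu> a)"
      unfolding m_def using f K periodic_test_measurable[OF f refl]
      by (intro integral_total_mixture[OF \<mu>_sets \<mu>_fin, where K = K]) (auto simp: periodic_test_def)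
    moreover have "continuous_on H f" "bounded (f ` H)" "\<And>x. x \<in> H \<Longrightarrow> 0 \<le> f x"
      "\<And>x j. x \<in> H \<Longrightarrow> j \<in> J \<Longrightarrow> f (x + j) = f x"
      using f by (simp_all add: periodic_test_def)
    note rauzy_measure_orbit_average[where f = f and a\<^sub>1 = a\<^sub>1, OF P LR rauzy this[unfolded H_def J_def] N_pos]
    ultimately show ?thesis
      by simp
  qed
  have mass: "emeasure m H = 1"
  proof -
    have "periodic_test (\<lambda>_. 1)"
      by (auto simp: periodic_test_def bounded_iff)
    from average[OF this] have "(\<lambda>n. (\<Sum>i<?N n. 1) / real (?N n)) \<longlonglongrightarrow> measure m H"
      by (simp only: space_m Bochner_Integration.lebesgue_integral_const) simp
    moreover have "(\<Sum>i<?N n. 1 :: real) / real (?N n) = 1" for n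
      using N_pos[of n] by simp
    ultimately have "(\<lambda>n. 1 :: real) \<longlonglongrightarrow> measure m H"
      by (simp only:)
    then show ?thesis
      using finite_measure.emeasure_eq_measure[OF m_fin] by (simp add: LIMSEQ_const_iff)
  qed
  have shift_\<alpha>: "(\<integral>x. f (x + ?\<alpha>) \<partial>m) = (\<integral>x. f x \<partial>m)" if f: "periodic_test f" for f
  proof -
    obtain K where K: "\<And>x. x \<in> H \<Longrightarrow> norm (f x) \<le> K"
      using periodic_test_bound[OF f] by blast
    show ?thesis
    proof (rule orbit_average_shift[OF _ N_lim])
      show "\<bar>f (of_nat i *\<^sub>R ?\<alpha>)\<bar> \<le> K" for i
        using K[of "of_nat i *\<^sub>R ?\<alpha>"] \<alpha> subspace by (simp add: subspace_scale)
      show "(\<lambda>n. (\<Sum>i<?N n. f (of_nat (Suc i) *\<^sub>R ?\<alpha>)) / real (?N n)) \<longlonglongrightarrow> (\<integral>x. f (x + ?\<alpha>) \<partial>m)"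
        using average[OF periodic_test_translate[OF f \<alpha>]] by (simp add: scaleR_add_left add.commute)
      show "(\<lambda>n. (\<Sum>i<?N n. f (of_nat i *\<^sub>R ?\<alpha>)) / real (?N n)) \<longlonglongrightarrow> (\<integral>x. f x \<partial>m)"
        by (rule average[OF f])
    qed
  qed
  have matrix: "(\<chi> i j. of_int ((subst_matrix P :: int ^ 'a ^ 'a) $ i $ j)) = (subst_matrix P :: real ^ 'a ^ 'a)"
    by (simp add: subst_matrix_def)
  have indep: "\<forall>i. n i = 0" if "(\<Sum>i\<in>UNIV. of_int (n i) * R $ i) = 0" for n :: "'a \<Rightarrow> int"
    using eigenvector_rationally_independent[OF irr _ \<open>R \<noteq> 0\<close> that] l(3) unfolding matrix by blast
  have dense: "\<exists>k :: int. \<exists>j\<in>J. norm (of_int k *\<^sub>R ?\<alpha> + j - h) < e" if "h \<in> H" "e > 0" for h e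
  proof -
    have h: "h \<in> hyperplane L"
      using that by (simp add: H_def)
    obtain n :: "'a \<Rightarrow> int" where n: "norm (proj_along L R (\<chi> i. of_int (n i)) - h) < e"
      by (rule integer_projections_dense[OF LR _ h \<open>e > 0\<close>]) (erule indep, blast)
    show ?thesis
      using n integer_projection_mod_lattice[of L R n a\<^sub>1]
      by (intro exI[of _ "\<Sum>i\<in>UNIV. n i"] bexI[rotated]) (auto simp: J_def)
  qed
  (* Here density turns the invariance under one rotation into invariance under all translations. *)
  have inv: "(\<integral>x. f (x + h) \<partial>m) = (\<integral>x. f x \<partial>m)" if "periodic_test f" "h \<in> H" for f h
    using translation_invariant_if_dense[OF m_fin m_sets \<alpha> shift_\<alpha> dense] that by blast
  have F: "transversal H F"
    using \<open>fundamental_domain H J F\<close> by (simp add: fundamental_domain_def transversal_def)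
  have "periodisation m = scale_measure (1 / emeasure leb F) leb"
    by (rule periodisation_eq_lebesgue[OF m_sets mass F emeasure_saturation_translate[OF m_fin m_sets inv]])
  then have "D * emeasure leb B = emeasure (periodisation m) B"
    using \<open>D = 1 / emeasure (subspace_lborel H) F\<close> by simp
  also have "\<dots> = (\<integral>\<^sup>+ j. emeasure m {x\<in>H. x + j \<in> B} \<partial>count_space J)"
    by (rule emeasure_periodisation[OF m_sets \<open>B \<in> sets (borel_on H)\<close>])
  also have "\<dots> = (\<integral>\<^sup>+ j. (\<Sum>a\<in>UNIV. emeasure (distr (\<mu> a) (borel_on H) (\<lambda>x. x + j)) B) \<partial>count_space J)"
  proof (rule nn_integral_cong)
    fix j assume "j \<in> space (count_space J)"
    then have j: "j \<in> H"
      using J_subset by auto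
    have "emeasure (distr (\<mu> a) (borel_on H) (\<lambda>x. x + j)) B = emeasure (\<mu> a) {x\<in>H. x + j \<in> B}" for a
      by (rule emeasure_distr_translate[OF \<mu>_sets j \<open>B \<in> sets (borel_on H)\<close>])
    then show "emeasure m {x\<in>H. x + j \<in> B} = (\<Sum>a\<in>UNIV. emeasure (distr (\<mu> a) (borel_on H) (\<lambda>x. x + j)) B)"
      using emeasure_m[OF sets_translate[OF j \<open>B \<in> sets (borel_on H)\<close>]] by simp
  qed
  also have "\<dots> = (\<Sum>\<^sub>\<infinity>j\<in>J. \<Sum>a\<in>UNIV. emeasure (distr (\<mu> a) (borel_on H) (\<lambda>x. x + j)) B)"
    by (rule infsum_ennreal_eq_nn_integral[OF countable_J, symmetric])
  finally show ?thesis
    by simp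
qed

end
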